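(* Let $G=(V,E)$ be an $n$-vertex graph with polynomially bounded growth with constant parameters $a,d>0$, and suppose the hardcore model on $G$ with fugacity $\lambda>0$ satisfies strong spatial mixing with constant parameters $C>0$, $\delta\in(0,1)$. Then the mixing time of the Glauber dynamics for the hardcore Gibbs distribution on $G$ is $O(n\log^3 n)$, where the implied constant depends only on $a,d,\lambda,C,\delta$.
   Context: $G$ has polynomially bounded growth with parameters $a,d$ if $|\{u\in V:\mathrm{dist}_G(u,v)\le r\}|\le a\cdot r^d$ for every $v\in V$ and every integer $r\ge1$. The hardcore model: $\mu$ on indicator vectors $\sigma\in\{0,1\}^V$ of independent sets $I$ with $\mu(I)\propto\lambda^{|I|}$. A pinning on $\Lambda\subseteq V$ is a configuration $\eta$ on $\Lambda$ with positive marginal probability; $\mu^\eta_v(c\mid\tau)$ is the probability that $\sigma_v=c$ under $\mu$ conditioned on $\sigma_\Lambda=\eta$ and $\sigma_W=\tau$. Strong spatial mixing with parameters $C,\delta$: for every pinning $\eta$ on any $\Lambda\subseteq V$, every $v\in V\setminus\Lambda$ and feasible spin $c$, every $W\subseteq V\setminus(\Lambda\cup\{v\})$ and every two feasible configurations $\tau,\xi$ on $W$, $\left|\frac{\mu^\eta_v(c\mid\tau)}{\mu^\eta_v(c\mid\xi)}-1\right|\le C(1-\delta)^{\mathrm{dist}_G(v,W)}$. The Glauber dynamics picks a uniformly random vertex each step and resamples its spin from the conditional distribution given the rest; its mixing time is the smallest $t$ such that from every initial configuration in the support, the distribution after $t$ steps is within total variation distance $1/4$ of $\mu$. *)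

theory Defs
  imports "HOL-Probability.Probability"
begin

section \<open>Graphs, distance and growth\<close>

definition simple_graph :: "'a set \<Rightarrow> 'a set set \<Rightarrow> bool" where
  "simple_graph V E \<longleftrightarrow> finite V \<and> (\<forall>e\<in>E. e \<subseteq> V \<and> card e = 2)"

text \<open>The length of a shortest walk; infinite if there is none.\<close>

definition graph_dist :: "'a set set \<Rightarrow> 'a \<Rightarrow> 'a \<Rightarrow> enat" where
  "graph_dist E u v = Inf (enat ` {k. (u, v) \<in> {(x, y). {x, y} \<in> E} ^^ k})"

definition graph_setdist :: "'a set set \<Rightarrow> 'a \<Rightarrow> 'a set \<Rightarrow> enat" where
  "graph_setdist E v W = (INF w\<in>W. graph_dist E v w)"

definition poly_growth :: "'a set \<Rightarrow> 'a set set \<Rightarrow> real \<Rightarrow> real \<Rightarrow> bool" where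
  "poly_growth V E a d \<longleftrightarrow>
    (\<forall>v\<in>V. \<forall>r::nat. r \<ge> 1 \<longrightarrow>
      real (card {u\<in>V. graph_dist E u v \<le> enat r}) \<le> a * real r powr d)"

section \<open>The hardcore model\<close>

definition independent_set :: "'a set \<Rightarrow> 'a set set \<Rightarrow> 'a set \<Rightarrow> bool" where
  "independent_set V E I \<longleftrightarrow> I \<subseteq> V \<and> (\<forall>e\<in>E. \<not> e \<subseteq> I)"

text \<open>A configuration on a set \<open>W\<close> is an element of \<open>W \<rightarrow>\<^sub>E {0, 1}\<close>; the restriction
  of a configuration \<open>\<sigma>\<close> to \<open>W\<close> is \<open>restrict \<sigma> W\<close>.\<close>

definition hardcore_weight ::
  "'a set \<Rightarrow> 'a set set \<Rightarrow> real \<Rightarrow> ('a \<Rightarrow> nat) \<Rightarrow> real" where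
  "hardcore_weight V E l \<sigma> =
    (if \<sigma> \<in> V \<rightarrow>\<^sub>E {0, 1} \<and> independent_set V E {v\<in>V. \<sigma> v = 1}
     then l ^ card {v\<in>V. \<sigma> v = 1} else 0)"

definition hardcore :: "'a set \<Rightarrow> 'a set set \<Rightarrow> real \<Rightarrow> ('a \<Rightarrow> nat) pmf" where
  "hardcore V E l =
    embed_pmf (\<lambda>\<sigma>. hardcore_weight V E l \<sigma> / (\<Sum>\<tau>\<in>V \<rightarrow>\<^sub>E {0, 1}. hardcore_weight V E l \<tau>))"

text \<open>For a finite simple graph the normalised weights do form a probability mass function,
  so that \<^const>\<open>embed_pmf\<close> is used within its specification.\<close>

lemma hardcore_partition_pos:
  assumes "simple_graph V E" "l > 0"
  shows "(\<Sum>\<tau>\<in>V \<rightarrow>\<^sub>E {0, 1}. hardcore_weight V E l \<tau>) > 0"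
proof -
  let ?z = "restrict (\<lambda>_. 0::nat) V"
  have fin: "finite (V \<rightarrow>\<^sub>E {0, 1::nat})"
    using assms by (intro finite_PiE) (auto simp: simple_graph_def)
  have e: "{v\<in>V. ?z v = 1} = {}" by auto
  have "e \<noteq> {}" if "e \<in> E" for e using that assms by (auto simp: simple_graph_def)
  then have "independent_set V E {v\<in>V. ?z v = 1}"
    unfolding e by (auto simp: independent_set_def)
  then have "hardcore_weight V E l ?z = 1"
    unfolding hardcore_weight_def e by auto
  moreover have "hardcore_weight V E l \<tau> \<ge> 0" for \<tau>
    using assms by (auto simp: hardcore_weight_def)
  ultimately show ?thesis
    by (intro sum_pos2[OF fin, of ?z]) auto
qed

lemma pmf_hardcore:
  assumes "simple_graph V E" "l > 0"
  shows "pmf (hardcore V E l) \<sigma> =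
    hardcore_weight V E l \<sigma> / (\<Sum>\<tau>\<in>V \<rightarrow>\<^sub>E {0, 1}. hardcore_weight V E l \<tau>)"
  unfolding hardcore_def
proof (rule pmf_embed_pmf)
  let ?Z = "\<Sum>\<tau>\<in>V \<rightarrow>\<^sub>E {0, 1}. hardcore_weight V E l \<tau>"
  let ?f = "\<lambda>\<sigma>. hardcore_weight V E l \<sigma> / ?Z"
  have Z: "?Z > 0" by (rule hardcore_partition_pos[OF assms])
  have nn: "hardcore_weight V E l \<tau> \<ge> 0" for \<tau>
    using assms by (auto simp: hardcore_weight_def)
  show f0: "0 \<le> ?f \<sigma>" for \<sigma>
    using Z nn by (intro divide_nonneg_pos) auto
  have fin: "finite (V \<rightarrow>\<^sub>E {0, 1::nat})"
    using assms by (intro finite_PiE) (auto simp: simple_graph_def)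
  have "(\<integral>\<^sup>+\<sigma>. ennreal (?f \<sigma>) \<partial>count_space UNIV) = (\<Sum>\<sigma>\<in>V \<rightarrow>\<^sub>E {0, 1}. ennreal (?f \<sigma>))"
    by (rule nn_integral_count_space'[OF fin]) (auto simp: hardcore_weight_def)
  also have "\<dots> = ennreal (\<Sum>\<sigma>\<in>V \<rightarrow>\<^sub>E {0, 1}. ?f \<sigma>)"
    using f0 by (intro sum_ennreal) auto
  also have "(\<Sum>\<sigma>\<in>V \<rightarrow>\<^sub>E {0, 1}. ?f \<sigma>) = 1"
    using Z by (simp add: sum_divide_distrib[symmetric])
  finally show "(\<integral>\<^sup>+\<sigma>. ennreal (?f \<sigma>) \<partial>count_space UNIV) = 1" by simp
qed

section \<open>Strong spatial mixing\<close>

definition pinning ::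
  "'a set \<Rightarrow> 'a set set \<Rightarrow> real \<Rightarrow> 'a set \<Rightarrow> ('a \<Rightarrow> nat) \<Rightarrow> bool" where
  "pinning V E l \<Lambda> \<eta> \<longleftrightarrow> \<eta> \<in> \<Lambda> \<rightarrow>\<^sub>E {0, 1} \<and>
    \<P>(\<sigma> in measure_pmf (hardcore V E l). restrict \<sigma> \<Lambda> = \<eta>) > 0"

text \<open>\<open>feasible_config V E l \<Lambda> \<eta> W \<tau>\<close>: the configuration \<open>\<tau>\<close> on \<open>W\<close> has positive
  probability under the distribution conditioned on the pinning \<open>\<eta>\<close> of \<open>\<Lambda>\<close>.\<close>

definition feasible_config ::
  "'a set \<Rightarrow> 'a set set \<Rightarrow> real \<Rightarrow> 'a set \<Rightarrow> ('a \<Rightarrow> nat) \<Rightarrow> 'a set \<Rightarrow> ('a \<Rightarrow> nat) \<Rightarrow> bool" where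
  "feasible_config V E l \<Lambda> \<eta> W \<tau> \<longleftrightarrow> \<tau> \<in> W \<rightarrow>\<^sub>E {0, 1} \<and>
    \<P>(\<sigma> in measure_pmf (hardcore V E l). restrict \<sigma> W = \<tau> \<bar> restrict \<sigma> \<Lambda> = \<eta>) > 0"

definition feasible_spin ::
  "'a set \<Rightarrow> 'a set set \<Rightarrow> real \<Rightarrow> 'a set \<Rightarrow> ('a \<Rightarrow> nat) \<Rightarrow> 'a \<Rightarrow> nat \<Rightarrow> bool" where
  "feasible_spin V E l \<Lambda> \<eta> v c \<longleftrightarrow> c \<in> {0, 1} \<and>
    \<P>(\<sigma> in measure_pmf (hardcore V E l). \<sigma> v = c \<bar> restrict \<sigma> \<Lambda> = \<eta>) > 0"

text \<open>The conditional marginal \<open>\<mu>\<^sup>\<eta>\<^sub>v(c | \<tau>)\<close>.\<close>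

definition cond_marginal ::
  "'a set \<Rightarrow> 'a set set \<Rightarrow> real \<Rightarrow> 'a set \<Rightarrow> ('a \<Rightarrow> nat) \<Rightarrow> 'a set \<Rightarrow> ('a \<Rightarrow> nat)
    \<Rightarrow> 'a \<Rightarrow> nat \<Rightarrow> real" where
  "cond_marginal V E l \<Lambda> \<eta> W \<tau> v c =
    \<P>(\<sigma> in measure_pmf (hardcore V E l).
        \<sigma> v = c \<bar> restrict \<sigma> \<Lambda> = \<eta> \<and> restrict \<sigma> W = \<tau>)"

text \<open>\<open>x\<close> to the power of a distance, used for \<open>0 < x < 1\<close> only; whence \<open>x\<^sup>\<infinity> = 0\<close>.\<close>

definition power_enat :: "real \<Rightarrow> enat \<Rightarrow> real" where
  "power_enat x k = (case k of enat m \<Rightarrow> x ^ m | \<infinity> \<Rightarrow> 0)"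

text \<open>The ratio of conditional marginals is only meaningful for a positive denominator.
  The denominator vanishes for \<open>c = 1\<close> when \<open>\<xi>\<close> occupies a neighbour of \<open>v\<close>; such
  pairs \<open>(\<tau>, \<xi>)\<close> impose no condition.\<close>

definition strong_spatial_mixing ::
  "'a set \<Rightarrow> 'a set set \<Rightarrow> real \<Rightarrow> real \<Rightarrow> real \<Rightarrow> bool" where
  "strong_spatial_mixing V E l C \<delta> \<longleftrightarrow>
    (\<forall>\<Lambda> \<eta> v c W \<tau> \<xi>.
      \<Lambda> \<subseteq> V \<longrightarrow> pinning V E l \<Lambda> \<eta> \<longrightarrow>
      v \<in> V - \<Lambda> \<longrightarrow> feasible_spin V E l \<Lambda> \<eta> v c \<longrightarrow>
      W \<subseteq> V - (\<Lambda> \<union> {v}) \<longrightarrow>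
      feasible_config V E l \<Lambda> \<eta> W \<tau> \<longrightarrow> feasible_config V E l \<Lambda> \<eta> W \<xi> \<longrightarrow>
      cond_marginal V E l \<Lambda> \<eta> W \<xi> v c > 0 \<longrightarrow>
      \<bar>cond_marginal V E l \<Lambda> \<eta> W \<tau> v c / cond_marginal V E l \<Lambda> \<eta> W \<xi> v c - 1\<bar>
        \<le> C * power_enat (1 - \<delta>) (graph_setdist E v W))"

section \<open>Glauber dynamics and mixing time\<close>

text \<open>Resampling the spin at \<open>v\<close> given the rest is sampling from the Gibbs distribution
  conditioned on agreeing with the current configuration off \<open>v\<close>.\<close>

definition glauber_step ::
  "'a set \<Rightarrow> 'a set set \<Rightarrow> real \<Rightarrow> ('a \<Rightarrow> nat) \<Rightarrow> ('a \<Rightarrow> nat) pmf" where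
  "glauber_step V E l \<sigma> =
    bind_pmf (pmf_of_set V)
      (\<lambda>v. cond_pmf (hardcore V E l) {\<sigma>'. restrict \<sigma>' (V - {v}) = restrict \<sigma> (V - {v})})"

primrec glauber ::
  "'a set \<Rightarrow> 'a set set \<Rightarrow> real \<Rightarrow> ('a \<Rightarrow> nat) \<Rightarrow> nat \<Rightarrow> ('a \<Rightarrow> nat) pmf" where
  "glauber V E l \<sigma> 0 = return_pmf \<sigma>"
| "glauber V E l \<sigma> (Suc t) = bind_pmf (glauber V E l \<sigma> t) (glauber_step V E l)"

definition tv_distance :: "'b pmf \<Rightarrow> 'b pmf \<Rightarrow> real" where
  "tv_distance p q = (SUP A. \<bar>measure_pmf.prob p A - measure_pmf.prob q A\<bar>)"

text \<open>Infinite if there is no such \<open>t\<close>.\<close>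

definition glauber_mixing_time :: "'a set \<Rightarrow> 'a set set \<Rightarrow> real \<Rightarrow> enat" where
  "glauber_mixing_time V E l =
    Inf (enat ` {t. \<forall>\<sigma>\<in>set_pmf (hardcore V E l).
      tv_distance (glauber V E l \<sigma> t) (hardcore V E l) \<le> 1 / 4})"

end

(* The proof bounds the decay of entropy. For a density f, write ent X f for the mean entropy of f
   given the spins in X. Since resampling v decreases ent {} f by exactly ent (V - {v}) f, the
   tensorization ent {} f <= k * (SUM v:V. ent (V - {v}) f) with k = O(log^2 n) contracts the
   entropy by 1 - 1/(kn) in every step, from an initial value O(n); this gives O(k n log n).

   Tensorization is proved by recursion on the number N of free vertices. Strong spatial mixing,
   applied to one vertex after the other, makes sets at distance R = O(log N) independent up to a
   relative error O(1/N), so the entropy splits, up to a factor 1 + O(1/N), into that of a ball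
   with a collar of width R and that of the complement of the ball. Radii are chosen, depending
   on f, so that a collar weighs no more than its ball; then carving out all vertices costs a
   constant factor and leaves pieces of size polylog(N) by polynomial growth. As the recursion
   N -> polylog(N) loses a constant factor at each of its O(log* N) levels, k = O(log^2 N)
   has room to spare. *)
theory Submission
  imports Defs "HOL-Real_Asymp.Real_Asymp"
begin

section \<open>Conditional entropy on a finite configuration space\<close>

text \<open>The boundary condition in \<open>ent X f\<close> is averaged over, never fixed. So
  tensorization for a small set of free vertices can be used in the middle of a large graph, and no
  single pinning has to be followed through the recursion. Hard constraints are the obstacle:
  conditional probabilities may vanish, and then spatial mixing says nothing. Therefore all sums run
  over the support, marginals are compared only at a spin that both configurations share, and
  distant boundary conditions are combined by emptying the vertices in between. The mixing error has
  to be relative. Applied to deviations from a conditional mean, it yields a product of two L1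
  deviations, which Pinsker bounds by a small multiple of the very entropy being split. At most N
  carvings occur, so an error of O(1/N) in each costs a constant. The weight of a vertex
  \<open>x\<close> is \<open>ent (V - {x}) f\<close> plus a small share of the total, so the charge
  for a collar is already in the form that tensorization permits. One level loses three factors 2:
  collar, raised weights, accumulated errors. For boundedly many vertices a bound exponential in
  their number is enough.\<close>

definition agree :: "'a set \<Rightarrow> ('a \<Rightarrow> 'b) \<Rightarrow> ('a \<Rightarrow> 'b) \<Rightarrow> bool" where
  "agree X \<sigma> \<tau> \<longleftrightarrow> (\<forall>x\<in>X. \<sigma> x = \<tau> x)"

lemma agree_refl [simp]: "agree X \<sigma> \<sigma>"
  by (simp add: agree_def)

lemma agree_sym: "agree X \<sigma> \<tau> \<Longrightarrow> agree X \<tau> \<sigma>"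
  by (simp add: agree_def)

lemma agree_mono: "agree Y \<sigma> \<tau> \<Longrightarrow> X \<subseteq> Y \<Longrightarrow> agree X \<sigma> \<tau>"
  by (auto simp: agree_def)

lemma agree_Un: "agree (X \<union> Y) \<sigma> \<tau> \<longleftrightarrow> agree X \<sigma> \<tau> \<and> agree Y \<sigma> \<tau>"
  by (auto simp: agree_def)

section \<open>Scalar entropy inequalities\<close>

lemma ent_term_le:
  fixes f g :: real
  assumes "f \<ge> 0" "g \<ge> 0" "f > 0 \<Longrightarrow> g > 0"
  shows "f * ln (g / f) \<le> g - f"
proof (cases "f = 0")
  case False
  then have "f > 0" "g > 0" using assms by auto
  then have "ln (g / f) \<le> g / f - 1" by (intro ln_le_minus_one) simp
  then have "f * ln (g / f) \<le> f * (g / f - 1)" using \<open>f > 0\<close> by (intro mult_left_mono) auto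
  also have "\<dots> = g - f" using \<open>f > 0\<close> by (simp add: field_simps)
  finally show ?thesis .
qed (use assms in auto)

text \<open>The bound ln x \<le> x - 1 at x = sqrt (m / f), multiplied by 2 f. It serves twice: for
  Pinsker, and to show that a jump of \<open>sqrt f\<close> across a single spin forces
  entropy.\<close>

lemma hellinger_le:
  fixes f m :: real
  assumes "f \<ge> 0" "m \<ge> 0" "f > 0 \<Longrightarrow> m > 0"
  shows "(sqrt f - sqrt m)\<^sup>2 \<le> f * ln (f / m) - f + m"
proof (cases "f = 0")
  case False
  then have f: "f > 0" and m: "m > 0" using assms by auto
  have "ln (sqrt m / sqrt f) \<le> sqrt m / sqrt f - 1" using f m by (intro ln_le_minus_one) simp
  moreover have "ln (sqrt m / sqrt f) = - ln (f / m) / 2"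
    using f m by (simp add: ln_div ln_sqrt diff_divide_distrib)
  ultimately have "f * (2 - 2 * (sqrt m / sqrt f)) \<le> f * ln (f / m)"
    using f by (intro mult_left_mono) auto
  moreover have "f * (2 - 2 * (sqrt m / sqrt f)) = 2 * f - 2 * (sqrt f * sqrt m)"
    using f by (simp add: field_simps)
  ultimately show ?thesis
    using f m by (simp add: power2_diff algebra_simps)
qed (use assms in auto)

text \<open>The weights need not sum to 1, and \<open>\<Omega>\<close> is the support: the class of
  any of its elements has positive mass, so conditioning never divides by 0 there.\<close>

locale weighted_configs =
  fixes \<Omega> :: "('a \<Rightarrow> 'b) set" and p :: "('a \<Rightarrow> 'b) \<Rightarrow> real"
  assumes fin [simp]: "finite \<Omega>" and p_pos: "\<sigma> \<in> \<Omega> \<Longrightarrow> p \<sigma> > 0"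
begin

section \<open>Classes, masses and conditional expectations\<close>

definition cls :: "'a set \<Rightarrow> ('a \<Rightarrow> 'b) \<Rightarrow> ('a \<Rightarrow> 'b) set" where
  "cls X \<sigma> = {\<tau>\<in>\<Omega>. agree X \<sigma> \<tau>}"

definition mass :: "'a set \<Rightarrow> ('a \<Rightarrow> 'b) \<Rightarrow> real" where
  "mass X \<sigma> = sum p (cls X \<sigma>)"

definition cexp :: "'a set \<Rightarrow> (('a \<Rightarrow> 'b) \<Rightarrow> real) \<Rightarrow> ('a \<Rightarrow> 'b) \<Rightarrow> real" where
  "cexp X f \<sigma> = (\<Sum>\<tau>\<in>cls X \<sigma>. p \<tau> * f \<tau>) / mass X \<sigma>"

text \<open>A larger \<open>X\<close> means fewer free spins. A zero of \<open>f\<close> contributes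
  0, the usual convention for 0 ln 0.\<close>

definition ent :: "'a set \<Rightarrow> (('a \<Rightarrow> 'b) \<Rightarrow> real) \<Rightarrow> real" where
  "ent X f = (\<Sum>\<sigma>\<in>\<Omega>. p \<sigma> * (f \<sigma> * ln (f \<sigma> / cexp X f \<sigma>)))"

lemma finite_cls [simp]: "finite (cls X \<sigma>)"
  by (simp add: cls_def)

lemma in_cls [simp]: "\<tau> \<in> cls X \<sigma> \<longleftrightarrow> \<tau> \<in> \<Omega> \<and> agree X \<sigma> \<tau>"
  by (simp add: cls_def)

lemma p_nonneg: "\<sigma> \<in> \<Omega> \<Longrightarrow> p \<sigma> \<ge> 0"
  using p_pos by force

lemma cls_eq: "agree X \<sigma> \<tau> \<Longrightarrow> cls X \<sigma> = cls X \<tau>"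
  by (auto simp: agree_def cls_def)

lemma cls_empty [simp]: "cls {} \<sigma> = \<Omega>"
  by (auto simp: agree_def cls_def)

lemma mass_pos: "\<sigma> \<in> \<Omega> \<Longrightarrow> mass X \<sigma> > 0"
  unfolding mass_def by (rule sum_pos2[of _ \<sigma>]) (auto intro: p_pos p_nonneg)

lemma mass_eq: "agree X \<sigma> \<tau> \<Longrightarrow> mass X \<sigma> = mass X \<tau>"
  by (simp add: mass_def cls_eq)

lemma cexp_eq: "agree X \<sigma> \<tau> \<Longrightarrow> cexp X f \<sigma> = cexp X f \<tau>"
  by (simp add: cexp_def cls_eq mass_eq)

lemma cexp_cong: "(\<And>\<tau>. \<tau> \<in> \<Omega> \<Longrightarrow> agree X \<sigma> \<tau> \<Longrightarrow> f \<tau> = g \<tau>) \<Longrightarrow> cexp X f \<sigma> = cexp X g \<sigma>"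
  unfolding cexp_def by (intro arg_cong2[of _ _ _ _ "(/)"] sum.cong) auto

lemma cexp_add: "cexp X (\<lambda>\<tau>. f \<tau> + g \<tau>) \<sigma> = cexp X f \<sigma> + cexp X g \<sigma>"
  by (simp add: cexp_def algebra_simps sum.distrib add_divide_distrib)

lemma cexp_diff: "cexp X (\<lambda>\<tau>. f \<tau> - g \<tau>) \<sigma> = cexp X f \<sigma> - cexp X g \<sigma>"
  by (simp add: cexp_def algebra_simps sum_subtractf diff_divide_distrib)

lemma cexp_cmult: "cexp X (\<lambda>\<tau>. c * f \<tau>) \<sigma> = c * cexp X f \<sigma>"
  by (simp add: cexp_def algebra_simps sum_distrib_left)

lemma cexp_pull:
  assumes "\<And>\<tau>. \<tau> \<in> \<Omega> \<Longrightarrow> agree X \<sigma> \<tau> \<Longrightarrow> g \<tau> = g \<sigma>"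
  shows "cexp X (\<lambda>\<tau>. g \<tau> * f \<tau>) \<sigma> = g \<sigma> * cexp X f \<sigma>"
  using cexp_cong[of X \<sigma> "\<lambda>\<tau>. g \<tau> * f \<tau>" "\<lambda>\<tau>. g \<sigma> * f \<tau>"] assms by (simp add: cexp_cmult)

lemma cexp_const: "\<sigma> \<in> \<Omega> \<Longrightarrow> cexp X (\<lambda>_. c) \<sigma> = c"
  using mass_pos[of \<sigma> X] by (simp add: cexp_def mass_def sum_distrib_right[symmetric])

lemma cexp_mono:
  assumes "\<sigma> \<in> \<Omega>" "\<And>\<tau>. \<tau> \<in> \<Omega> \<Longrightarrow> agree X \<sigma> \<tau> \<Longrightarrow> f \<tau> \<le> g \<tau>"
  shows "cexp X f \<sigma> \<le> cexp X g \<sigma>"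
  unfolding cexp_def using assms mass_pos[of \<sigma> X]
  by (intro divide_right_mono sum_mono mult_left_mono) (auto intro: p_nonneg)

lemma cexp_nonneg:
  assumes "\<sigma> \<in> \<Omega>" "\<And>\<tau>. \<tau> \<in> \<Omega> \<Longrightarrow> f \<tau> \<ge> 0"
  shows "cexp X f \<sigma> \<ge> 0"
  using cexp_mono[OF assms(1), of X "\<lambda>_. 0" f] assms by (simp add: cexp_const)

lemma cexp_pos:
  assumes "\<sigma> \<in> \<Omega>" "\<And>\<tau>. \<tau> \<in> \<Omega> \<Longrightarrow> f \<tau> \<ge> 0" "f \<sigma> > 0"
  shows "cexp X f \<sigma> > 0"
proof -
  have "(\<Sum>\<tau>\<in>cls X \<sigma>. p \<tau> * f \<tau>) > 0"
    using assms p_pos[of \<sigma>] p_nonneg by (intro sum_pos2[of _ \<sigma>]) auto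
  then show ?thesis unfolding cexp_def using mass_pos[OF assms(1)] by simp
qed

lemma cexp_abs:
  assumes "\<sigma> \<in> \<Omega>"
  shows "\<bar>cexp X f \<sigma>\<bar> \<le> cexp X (\<lambda>\<tau>. \<bar>f \<tau>\<bar>) \<sigma>"
proof -
  have "cexp X f \<sigma> \<le> cexp X (\<lambda>\<tau>. \<bar>f \<tau>\<bar>) \<sigma>"
    "cexp X (\<lambda>\<tau>. (-1) * f \<tau>) \<sigma> \<le> cexp X (\<lambda>\<tau>. \<bar>f \<tau>\<bar>) \<sigma>"
    using assms by (auto intro!: cexp_mono)
  then show ?thesis unfolding cexp_cmult by linarith
qed

text \<open>A class of \<open>X\<close> is a disjoint union of classes of \<open>Y\<close>. After
  exchanging the two sums, the weights \<open>p \<tau> / mass Y \<tau>\<close> over one class of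
  \<open>Y\<close> add up to 1.\<close>

lemma cexp_tower:
  assumes "X \<subseteq> Y" "\<sigma> \<in> \<Omega>"
  shows "cexp X (cexp Y f) \<sigma> = cexp X f \<sigma>"
proof -
  let ?C = "cls X \<sigma>"
  have sub: "cls Y \<tau> = {\<tau>'\<in>?C. agree Y \<tau> \<tau>'}" if "\<tau> \<in> ?C" for \<tau>
    using that assms(1) by (auto simp: agree_def)
  have "(\<Sum>\<tau>\<in>?C. p \<tau> * cexp Y f \<tau>)
      = (\<Sum>\<tau>\<in>?C. \<Sum>\<tau>'\<in>{\<tau>'\<in>?C. agree Y \<tau> \<tau>'}. p \<tau> / mass Y \<tau> * (p \<tau>' * f \<tau>'))"
    unfolding cexp_def
    by (intro sum.cong refl) (simp add: sub[symmetric] sum_distrib_left sum_divide_distrib del: in_cls)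
  also have "\<dots> = (\<Sum>\<tau>'\<in>?C. \<Sum>\<tau>\<in>{\<tau>\<in>?C. agree Y \<tau> \<tau>'}. p \<tau> / mass Y \<tau> * (p \<tau>' * f \<tau>'))"
    by (rule sum.swap_restrict) auto
  also have "\<dots> = (\<Sum>\<tau>'\<in>?C. p \<tau>' * f \<tau>')"
  proof (intro sum.cong refl)
    fix \<tau>' assume t: "\<tau>' \<in> ?C"
    have "{\<tau>\<in>?C. agree Y \<tau> \<tau>'} = cls Y \<tau>'" using sub[OF t] by (auto intro: agree_sym)
    then have "(\<Sum>\<tau>\<in>{\<tau>\<in>?C. agree Y \<tau> \<tau>'}. p \<tau> / mass Y \<tau> * (p \<tau>' * f \<tau>'))
        = (\<Sum>\<tau>\<in>cls Y \<tau>'. p \<tau> / mass Y \<tau>' * (p \<tau>' * f \<tau>'))"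
      by (intro sum.cong) (auto simp: mass_eq)
    also have "\<dots> = mass Y \<tau>' / mass Y \<tau>' * (p \<tau>' * f \<tau>')"
      by (simp only: mass_def sum_distrib_right sum_divide_distrib)
    finally show "(\<Sum>\<tau>\<in>{\<tau>\<in>?C. agree Y \<tau> \<tau>'}. p \<tau> / mass Y \<tau> * (p \<tau>' * f \<tau>')) = p \<tau>' * f \<tau>'"
      using mass_pos[of \<tau>' Y] t by simp
  qed
  finally show ?thesis by (simp add: cexp_def)
qed

lemma sum_cexp: "(\<Sum>\<sigma>\<in>\<Omega>. p \<sigma> * cexp X f \<sigma>) = (\<Sum>\<sigma>\<in>\<Omega>. p \<sigma> * f \<sigma>)"
proof (cases "\<Omega> = {}")
  case False
  then obtain \<sigma> where "\<sigma> \<in> \<Omega>" by auto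
  from cexp_tower[of "{}" X \<sigma> f] this mass_pos[OF this, of "{}"] show ?thesis
    by (simp add: cexp_def)
qed auto

lemma cexp_Cauchy_Schwarz:
  assumes "\<sigma> \<in> \<Omega>"
  shows "(cexp X (\<lambda>\<tau>. f \<tau> * g \<tau>) \<sigma>)\<^sup>2 \<le> cexp X (\<lambda>\<tau>. (f \<tau>)\<^sup>2) \<sigma> * cexp X (\<lambda>\<tau>. (g \<tau>)\<^sup>2) \<sigma>"
proof -
  let ?C = "cls X \<sigma>"
  have "(\<Sum>\<tau>\<in>?C. p \<tau> * (f \<tau> * g \<tau>))\<^sup>2 = (\<Sum>\<tau>\<in>?C. (sqrt (p \<tau>) * f \<tau>) * (sqrt (p \<tau>) * g \<tau>))\<^sup>2"
  proof (intro arg_cong[of _ _ "\<lambda>x. x\<^sup>2"] sum.cong refl)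
    fix \<tau> assume "\<tau> \<in> ?C"
    then have "p \<tau> = sqrt (p \<tau>) * sqrt (p \<tau>)" by (simp add: p_nonneg)
    then show "p \<tau> * (f \<tau> * g \<tau>) = (sqrt (p \<tau>) * f \<tau>) * (sqrt (p \<tau>) * g \<tau>)"
      by (metis mult.assoc mult.left_commute)
  qed
  also have "\<dots> \<le> (\<Sum>\<tau>\<in>?C. (sqrt (p \<tau>) * f \<tau>)\<^sup>2) * (\<Sum>\<tau>\<in>?C. (sqrt (p \<tau>) * g \<tau>)\<^sup>2)"
    by (rule Cauchy_Schwarz_ineq_sum)
  also have "\<dots> = (\<Sum>\<tau>\<in>?C. p \<tau> * (f \<tau>)\<^sup>2) * (\<Sum>\<tau>\<in>?C. p \<tau> * (g \<tau>)\<^sup>2)"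
    by (intro arg_cong2[of _ _ _ _ "(*)"] sum.cong) (auto simp: p_nonneg power_mult_distrib)
  finally show ?thesis
    unfolding cexp_def power_divide times_divide_times_eq power2_eq_square[of "mass X \<sigma>"]
    by (intro divide_right_mono) auto
qed

section \<open>Hellinger and Pinsker bounds\<close>

text \<open>The added terms cancel in the mean by the tower property. They make the integrand
  nonnegative pointwise, which \<open>f \<tau> * ln (f \<tau> / cexp Y f \<tau>)\<close> alone is
  not.\<close>

lemma cexp_ent_shift:
  assumes "\<sigma> \<in> \<Omega>" "X \<subseteq> Y"
  shows "cexp X (\<lambda>\<tau>. f \<tau> * ln (f \<tau> / cexp Y f \<tau>) - f \<tau> + cexp Y f \<tau>) \<sigma>
    = cexp X (\<lambda>\<tau>. f \<tau> * ln (f \<tau> / cexp Y f \<tau>)) \<sigma>"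
  using cexp_tower[of X Y \<sigma> f] assms by (simp add: cexp_add cexp_diff)

text \<open>The entropy is relative to the finer \<open>Y\<close> but localised to a class of
  \<open>X\<close>: the bound for small blocks is proved class by class, before averaging over the
  boundary.\<close>

lemma hellinger_ent:
  assumes "\<sigma> \<in> \<Omega>" "X \<subseteq> Y" "\<And>\<tau>. \<tau> \<in> \<Omega> \<Longrightarrow> f \<tau> \<ge> 0"
  shows "cexp X (\<lambda>\<tau>. (sqrt (f \<tau>) - sqrt (cexp Y f \<tau>))\<^sup>2) \<sigma>
    \<le> cexp X (\<lambda>\<tau>. f \<tau> * ln (f \<tau> / cexp Y f \<tau>)) \<sigma>"
  unfolding cexp_ent_shift[OF assms(1,2), symmetric] using assms
  by (intro cexp_mono hellinger_le) (auto intro: cexp_nonneg cexp_pos)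

lemma ent_eq_cexp: "ent X f = (\<Sum>\<sigma>\<in>\<Omega>. p \<sigma> * cexp Y (\<lambda>\<tau>. f \<tau> * ln (f \<tau> / cexp X f \<tau>)) \<sigma>)"
  by (simp add: sum_cexp ent_def)

lemma ent_nonneg:
  assumes "\<And>\<tau>. \<tau> \<in> \<Omega> \<Longrightarrow> f \<tau> \<ge> 0"
  shows "ent X f \<ge> 0"
  unfolding ent_eq_cexp[of X f X]
proof (intro sum_nonneg mult_nonneg_nonneg)
  fix \<sigma> assume s: "\<sigma> \<in> \<Omega>"
  show "p \<sigma> \<ge> 0" using p_nonneg s .
  have "0 \<le> cexp X (\<lambda>\<tau>. (sqrt (f \<tau>) - sqrt (cexp X f \<tau>))\<^sup>2) \<sigma>"
    using s by (intro cexp_nonneg) auto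
  also note hellinger_ent[OF s order_refl assms]
  finally show "0 \<le> cexp X (\<lambda>\<tau>. f \<tau> * ln (f \<tau> / cexp X f \<tau>)) \<sigma>" by simp
qed

text \<open>Cauchy-Schwarz for the factors sqrt f - sqrt m and sqrt f + sqrt m of f - m: the first
  has mean square at most the entropy, the second at most 4 m. The sharp constant would be
  2.\<close>

lemma pinsker:
  fixes X :: "'a set" and f :: "('a \<Rightarrow> 'b) \<Rightarrow> real"
  assumes s: "\<sigma> \<in> \<Omega>" and f: "\<And>\<tau>. \<tau> \<in> \<Omega> \<Longrightarrow> f \<tau> \<ge> 0"
  defines "m \<equiv> cexp X f \<sigma>"
  shows "(cexp X (\<lambda>\<tau>. \<bar>f \<tau> - m\<bar>) \<sigma>)\<^sup>2 \<le> 4 * m * cexp X (\<lambda>\<tau>. f \<tau> * ln (f \<tau> / m)) \<sigma>"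
proof -
  have m: "m \<ge> 0" unfolding m_def using s f by (rule cexp_nonneg)
  have e: "\<bar>f \<tau> - m\<bar> = \<bar>sqrt (f \<tau>) - sqrt m\<bar> * (sqrt (f \<tau>) + sqrt m)" if "\<tau> \<in> \<Omega>" for \<tau>
  proof -
    have "f \<tau> - m = (sqrt (f \<tau>) - sqrt m) * (sqrt (f \<tau>) + sqrt m)"
      using f[OF that] m by (simp add: algebra_simps)
    moreover have "sqrt (f \<tau>) + sqrt m \<ge> 0" using f[OF that] m by simp
    ultimately show ?thesis by (simp add: abs_mult)
  qed
  have "cexp X (\<lambda>\<tau>. \<bar>f \<tau> - m\<bar>) \<sigma> = cexp X (\<lambda>\<tau>. \<bar>sqrt (f \<tau>) - sqrt m\<bar> * (sqrt (f \<tau>) + sqrt m)) \<sigma>"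
    by (rule cexp_cong) (rule e)
  then have "(cexp X (\<lambda>\<tau>. \<bar>f \<tau> - m\<bar>) \<sigma>)\<^sup>2
      \<le> cexp X (\<lambda>\<tau>. \<bar>sqrt (f \<tau>) - sqrt m\<bar>\<^sup>2) \<sigma> * cexp X (\<lambda>\<tau>. (sqrt (f \<tau>) + sqrt m)\<^sup>2) \<sigma>"
    using cexp_Cauchy_Schwarz[OF s, of X "\<lambda>\<tau>. \<bar>sqrt (f \<tau>) - sqrt m\<bar>" "\<lambda>\<tau>. sqrt (f \<tau>) + sqrt m"]
    by simp
  also have "\<dots> \<le> cexp X (\<lambda>\<tau>. f \<tau> * ln (f \<tau> / m)) \<sigma> * (4 * m)"
  proof (rule mult_mono)
    have c: "cexp X f \<tau> = m" if "agree X \<sigma> \<tau>" for \<tau>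
      unfolding m_def using that by (intro cexp_eq[symmetric])
    have "cexp X (\<lambda>\<tau>. \<bar>sqrt (f \<tau>) - sqrt m\<bar>\<^sup>2) \<sigma> = cexp X (\<lambda>\<tau>. (sqrt (f \<tau>) - sqrt (cexp X f \<tau>))\<^sup>2) \<sigma>"
      by (rule cexp_cong) (auto simp: c)
    also note hellinger_ent[OF s order_refl f]
    also have "cexp X (\<lambda>\<tau>. f \<tau> * ln (f \<tau> / cexp X f \<tau>)) \<sigma> = cexp X (\<lambda>\<tau>. f \<tau> * ln (f \<tau> / m)) \<sigma>"
      by (rule cexp_cong) (auto simp: c)
    finally show "cexp X (\<lambda>\<tau>. \<bar>sqrt (f \<tau>) - sqrt m\<bar>\<^sup>2) \<sigma> \<le> cexp X (\<lambda>\<tau>. f \<tau> * ln (f \<tau> / m)) \<sigma>"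
      by simp
    then show "0 \<le> cexp X (\<lambda>\<tau>. f \<tau> * ln (f \<tau> / m)) \<sigma>"
      using cexp_nonneg[OF s, of "\<lambda>\<tau>. \<bar>sqrt (f \<tau>) - sqrt m\<bar>\<^sup>2" X] by simp
    have "cexp X (\<lambda>\<tau>. (sqrt (f \<tau>) + sqrt m)\<^sup>2) \<sigma> \<le> cexp X (\<lambda>\<tau>. 2 * f \<tau> + 2 * m) \<sigma>"
    proof (rule cexp_mono[OF s])
      fix \<tau> assume "\<tau> \<in> \<Omega>"
      then have "f \<tau> \<ge> 0" by (rule f)
      have "0 \<le> (sqrt (f \<tau>) - sqrt m)\<^sup>2" by simp
      then show "(sqrt (f \<tau>) + sqrt m)\<^sup>2 \<le> 2 * f \<tau> + 2 * m"
        using \<open>f \<tau> \<ge> 0\<close> m by (simp add: power2_sum power2_diff)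
    qed
    also have "\<dots> = 4 * m" using s by (simp add: cexp_add cexp_cmult cexp_const m_def)
    finally show "cexp X (\<lambda>\<tau>. (sqrt (f \<tau>) + sqrt m)\<^sup>2) \<sigma> \<le> 4 * m" .
    show "0 \<le> cexp X (\<lambda>\<tau>. (sqrt (f \<tau>) + sqrt m)\<^sup>2) \<sigma>" by (intro cexp_nonneg[OF s]) auto
  qed
  finally show ?thesis by (simp add: mult_ac)
qed

section \<open>Quasi-factorization over two blocks\<close>

text \<open>The variational formula for entropy: no trial function \<open>h\<close> does better than
  \<open>f\<close> itself. In the proof, \<open>F / k * h\<close> is \<open>h\<close> rescaled to
  the conditional mean of \<open>f\<close>, which makes it comparable with \<open>f\<close> through
  the tangent bound for the logarithm.\<close>

lemma ent_variational:
  assumes f: "\<And>\<tau>. \<tau> \<in> \<Omega> \<Longrightarrow> f \<tau> \<ge> 0" and h: "\<And>\<tau>. \<tau> \<in> \<Omega> \<Longrightarrow> h \<tau> \<ge> 0"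
    and fh: "\<And>\<tau>. \<tau> \<in> \<Omega> \<Longrightarrow> f \<tau> > 0 \<Longrightarrow> h \<tau> > 0"
  shows "(\<Sum>\<sigma>\<in>\<Omega>. p \<sigma> * (f \<sigma> * ln (h \<sigma> / cexp Y h \<sigma>))) \<le> ent Y f"
proof -
  define F where "F = cexp Y f"
  define k where "k = cexp Y h"
  have F0: "F \<sigma> \<ge> 0" and k0: "k \<sigma> \<ge> 0" if "\<sigma> \<in> \<Omega>" for \<sigma>
    unfolding F_def k_def using that f h by (auto intro: cexp_nonneg)
  have pw: "f \<sigma> * ln (h \<sigma> / k \<sigma>) \<le> f \<sigma> * ln (f \<sigma> / F \<sigma>) + (F \<sigma> / k \<sigma> * h \<sigma> - f \<sigma>)" if s: "\<sigma> \<in> \<Omega>" for \<sigma>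
  proof (cases "f \<sigma> = 0")
    case True
    then show ?thesis using F0[OF s] k0[OF s] h[OF s] by simp
  next
    case False
    then have fp: "f \<sigma> > 0" using f[OF s] by simp
    have hp: "h \<sigma> > 0" using fh s fp by auto
    have Fp: "F \<sigma> > 0" unfolding F_def using s f fp by (intro cexp_pos) auto
    have kp: "k \<sigma> > 0" unfolding k_def using s h hp by (intro cexp_pos) auto
    have "f \<sigma> * ln (F \<sigma> / k \<sigma> * h \<sigma> / f \<sigma>) \<le> F \<sigma> / k \<sigma> * h \<sigma> - f \<sigma>"
      using fp hp Fp kp by (intro ent_term_le) auto
    moreover have "ln (F \<sigma> / k \<sigma> * h \<sigma> / f \<sigma>) = ln (h \<sigma> / k \<sigma>) - ln (f \<sigma> / F \<sigma>)"
      using fp hp Fp kp by (simp add: ln_div ln_mult)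
    ultimately show ?thesis by (simp only: right_diff_distrib)
  qed
  have "(\<Sum>\<sigma>\<in>\<Omega>. p \<sigma> * (f \<sigma> * ln (h \<sigma> / k \<sigma>)))
     \<le> (\<Sum>\<sigma>\<in>\<Omega>. p \<sigma> * (f \<sigma> * ln (f \<sigma> / F \<sigma>) + (F \<sigma> / k \<sigma> * h \<sigma> - f \<sigma>)))"
    using pw p_nonneg by (intro sum_mono mult_left_mono) auto
  also have "\<dots> = ent Y f + ((\<Sum>\<sigma>\<in>\<Omega>. p \<sigma> * (F \<sigma> / k \<sigma> * h \<sigma>)) - (\<Sum>\<sigma>\<in>\<Omega>. p \<sigma> * f \<sigma>))"
    by (simp add: ent_def F_def distrib_left right_diff_distrib sum.distrib sum_subtractf)
  also have "(\<Sum>\<sigma>\<in>\<Omega>. p \<sigma> * (F \<sigma> / k \<sigma> * h \<sigma>)) = (\<Sum>\<sigma>\<in>\<Omega>. p \<sigma> * cexp Y (\<lambda>\<tau>. F \<tau> / k \<tau> * h \<tau>) \<sigma>)"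
    by (rule sum_cexp[symmetric])
  also have "\<dots> = (\<Sum>\<sigma>\<in>\<Omega>. p \<sigma> * (F \<sigma> / k \<sigma> * k \<sigma>))"
    unfolding F_def k_def
    by (intro sum.cong refl arg_cong2[of _ _ _ _ "(*)"] cexp_pull) (metis cexp_eq)
  \<comment> \<open>Where \<open>k\<close> vanishes, \<open>F / k * k\<close> is 0 by the convention
    for division, and an inequality is enough.\<close>
  also have "\<dots> \<le> (\<Sum>\<sigma>\<in>\<Omega>. p \<sigma> * F \<sigma>)"
    using F0 p_nonneg by (intro sum_mono mult_left_mono) auto
  also have "\<dots> = (\<Sum>\<sigma>\<in>\<Omega>. p \<sigma> * f \<sigma>)" unfolding F_def by (rule sum_cexp)
  finally show ?thesis unfolding k_def by simp
qed

text \<open>Cesi's quasi-factorization of entropy, obtained from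
  \<open>ln (f / m) = ln (f / h) + ln (h / k) + ln (k / m)\<close>: the three terms are controlled by the
  first block, the second block and (through Pinsker) by \<open>\<epsilon>\<close> times the full entropy.\<close>

lemma ent_two_blocks:
  assumes f: "\<And>\<tau>. \<tau> \<in> \<Omega> \<Longrightarrow> f \<tau> \<ge> 0" and eps: "\<epsilon> \<ge> 0"
    and mix: "\<And>g \<sigma>. \<sigma> \<in> \<Omega> \<Longrightarrow> (\<And>\<rho> \<tau>. \<rho> \<in> \<Omega> \<Longrightarrow> \<tau> \<in> \<Omega> \<Longrightarrow> agree (X \<union> D) \<rho> \<tau> \<Longrightarrow> g \<rho> = g \<tau>) \<Longrightarrow>
      \<bar>cexp (X \<union> S) g \<sigma> - cexp X g \<sigma>\<bar> \<le> \<epsilon> * cexp X (\<lambda>\<tau>. \<bar>g \<tau>\<bar>) \<sigma>"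
  shows "(1 - 4 * \<epsilon>) * ent X f \<le> ent (X \<union> D) f + ent (X \<union> S) f"
proof -
  \<comment> \<open>\<open>h\<close> depends only on the spins in \<open>X \<union> D\<close>, so
    \<open>mix\<close> applies to it. As \<open>S\<close> hardly influences it, \<open>k\<close> is
    close to \<open>m\<close>.\<close>
  define h where "h = cexp (X \<union> D) f"
  define k where "k = cexp (X \<union> S) h"
  define m where "m = cexp X f"
  define q where "q \<sigma> = cexp X (\<lambda>\<tau>. \<bar>f \<tau> - m \<sigma>\<bar>) \<sigma>" for \<sigma>
  have h0: "h \<sigma> \<ge> 0" if "\<sigma> \<in> \<Omega>" for \<sigma> unfolding h_def using that f by (rule cexp_nonneg)
  have m0: "m \<sigma> \<ge> 0" if "\<sigma> \<in> \<Omega>" for \<sigma> unfolding m_def using that f by (rule cexp_nonneg)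
  have hp: "h \<sigma> > 0" if "\<sigma> \<in> \<Omega>" "f \<sigma> > 0" for \<sigma> unfolding h_def using that f by (intro cexp_pos) auto
  have kp: "k \<sigma> > 0" if "\<sigma> \<in> \<Omega>" "f \<sigma> > 0" for \<sigma>
    unfolding k_def using that h0 hp by (intro cexp_pos) auto
  have mp: "m \<sigma> > 0" if "\<sigma> \<in> \<Omega>" "f \<sigma> > 0" for \<sigma> unfolding m_def using that f by (intro cexp_pos) auto
  have meq: "m \<tau> = m \<sigma>" if "agree X \<sigma> \<tau>" for \<sigma> \<tau>
    unfolding m_def using that by (intro cexp_eq[symmetric])
  have heq: "h \<tau> = h \<sigma>" if "agree (X \<union> D) \<sigma> \<tau>" for \<sigma> \<tau>
    unfolding h_def using that by (intro cexp_eq[symmetric])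
  have keq: "k \<tau> = k \<sigma>" if "agree (X \<union> S) \<sigma> \<tau>" for \<sigma> \<tau>
    unfolding k_def using that by (intro cexp_eq[symmetric])
  have cexp_h: "cexp X h \<sigma> = m \<sigma>" if "\<sigma> \<in> \<Omega>" for \<sigma>
    unfolding h_def m_def using that by (intro cexp_tower) auto
  have cexp_k: "cexp X k \<sigma> = m \<sigma>" if "\<sigma> \<in> \<Omega>" for \<sigma>
    unfolding k_def using cexp_tower[of X "X \<union> S" \<sigma> h] cexp_h that by simp
  have q0: "q \<sigma> \<ge> 0" if "\<sigma> \<in> \<Omega>" for \<sigma> unfolding q_def using that by (intro cexp_nonneg) auto
  have km: "\<bar>k \<sigma> - m \<sigma>\<bar> \<le> \<epsilon> * q \<sigma>" if s: "\<sigma> \<in> \<Omega>" for \<sigma>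
  proof -
    \<comment> \<open>Subtracting the constant \<open>m \<sigma>\<close> before using
      \<open>mix\<close> makes the error proportional to the deviation \<open>q \<sigma>\<close>
      instead of the mean \<open>m \<sigma>\<close>.\<close>
    have "\<bar>cexp (X \<union> S) (\<lambda>\<tau>. h \<tau> - m \<sigma>) \<sigma> - cexp X (\<lambda>\<tau>. h \<tau> - m \<sigma>) \<sigma>\<bar>
        \<le> \<epsilon> * cexp X (\<lambda>\<tau>. \<bar>h \<tau> - m \<sigma>\<bar>) \<sigma>"
      by (rule mix[OF s]) (metis heq)
    also have "cexp X (\<lambda>\<tau>. \<bar>h \<tau> - m \<sigma>\<bar>) \<sigma> \<le> cexp X (cexp (X \<union> D) (\<lambda>\<tau>. \<bar>f \<tau> - m \<sigma>\<bar>)) \<sigma>"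
    proof (rule cexp_mono[OF s])
      fix \<tau> assume t: "\<tau> \<in> \<Omega>"
      have "h \<tau> - m \<sigma> = cexp (X \<union> D) (\<lambda>\<tau>. f \<tau> - m \<sigma>) \<tau>"
        using t by (simp add: cexp_diff cexp_const h_def)
      then show "\<bar>h \<tau> - m \<sigma>\<bar> \<le> cexp (X \<union> D) (\<lambda>\<tau>. \<bar>f \<tau> - m \<sigma>\<bar>) \<tau>"
        using cexp_abs[OF t] by simp
    qed
    also have "\<dots> = q \<sigma>" unfolding q_def using s by (intro cexp_tower) auto
    finally show ?thesis
      using eps s cexp_h by (simp add: cexp_diff cexp_const k_def mult_left_mono)
  qed
  have third: "cexp X (\<lambda>\<tau>. f \<tau> * ln (k \<tau> / m \<tau>)) \<sigma>
      \<le> 4 * \<epsilon> * cexp X (\<lambda>\<tau>. f \<tau> * ln (f \<tau> / m \<tau>)) \<sigma>" if s: "\<sigma> \<in> \<Omega>" for \<sigma>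
  proof -
    have "cexp X (\<lambda>\<tau>. f \<tau> * ln (k \<tau> / m \<tau>)) \<sigma>
        \<le> cexp X (\<lambda>\<tau>. inverse (m \<tau>) * (f \<tau> * (k \<tau> - m \<tau>))) \<sigma>"
    proof (rule cexp_mono[OF s])
      fix \<tau> assume t: "\<tau> \<in> \<Omega>"
      show "f \<tau> * ln (k \<tau> / m \<tau>) \<le> inverse (m \<tau>) * (f \<tau> * (k \<tau> - m \<tau>))"
      proof (cases "f \<tau> = 0")
        case False
        then have fp: "f \<tau> > 0" using f[OF t] by simp
        have "ln (k \<tau> / m \<tau>) \<le> k \<tau> / m \<tau> - 1"
          using kp[OF t fp] mp[OF t fp] by (intro ln_le_minus_one) simp
        then have "f \<tau> * ln (k \<tau> / m \<tau>) \<le> f \<tau> * (k \<tau> / m \<tau> - 1)"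
          using fp by (intro mult_left_mono) auto
        then show ?thesis using mp[OF t fp] by (simp add: field_simps)
      qed auto
    qed
    also have "\<dots> = inverse (m \<sigma>) * cexp X (\<lambda>\<tau>. f \<tau> * (k \<tau> - m \<tau>)) \<sigma>"
      using meq by (intro cexp_pull) metis
    \<comment> \<open>\<open>f\<close> may be centred at \<open>m \<sigma>\<close> because
      \<open>k - m\<close> has conditional mean 0. Now both factors are deviations, so the square of
      \<open>q \<sigma>\<close> appears; Pinsker turns it into \<open>m \<sigma>\<close> times an
      entropy, which cancels the inverse in front.\<close>
    also have "cexp X (\<lambda>\<tau>. f \<tau> * (k \<tau> - m \<tau>)) \<sigma>
        = cexp X (\<lambda>\<tau>. (f \<tau> - m \<sigma>) * (k \<tau> - m \<sigma>) + m \<sigma> * (k \<tau> - m \<sigma>)) \<sigma>"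
      using meq by (intro cexp_cong) (auto simp: algebra_simps)
    also have "\<dots> = cexp X (\<lambda>\<tau>. (f \<tau> - m \<sigma>) * (k \<tau> - m \<sigma>)) \<sigma>"
      using s cexp_k by (simp add: cexp_add cexp_diff cexp_cmult cexp_const)
    also have "\<dots> \<le> cexp X (\<lambda>\<tau>. (\<epsilon> * q \<sigma>) * \<bar>f \<tau> - m \<sigma>\<bar>) \<sigma>"
    proof (rule cexp_mono[OF s])
      fix \<tau> assume t: "\<tau> \<in> \<Omega>" "agree X \<sigma> \<tau>"
      have qeq: "q \<tau> = q \<sigma>" unfolding q_def using t meq[of \<sigma> \<tau>] by (simp add: cexp_eq[of X \<sigma> \<tau>])
      have "(f \<tau> - m \<sigma>) * (k \<tau> - m \<sigma>) \<le> \<bar>f \<tau> - m \<sigma>\<bar> * \<bar>k \<tau> - m \<sigma>\<bar>"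
        by (metis abs_ge_self abs_mult)
      also have "\<dots> \<le> \<bar>f \<tau> - m \<sigma>\<bar> * (\<epsilon> * q \<sigma>)"
        using km[OF t(1)] meq[OF t(2)] qeq by (intro mult_left_mono) auto
      finally show "(f \<tau> - m \<sigma>) * (k \<tau> - m \<sigma>) \<le> (\<epsilon> * q \<sigma>) * \<bar>f \<tau> - m \<sigma>\<bar>" by (simp add: mult_ac)
    qed
    also have "\<dots> = \<epsilon> * (q \<sigma>)\<^sup>2" by (simp add: cexp_cmult q_def power2_eq_square)
    also have "\<dots> \<le> \<epsilon> * (4 * m \<sigma> * cexp X (\<lambda>\<tau>. f \<tau> * ln (f \<tau> / m \<sigma>)) \<sigma>)"
      unfolding q_def using eps pinsker[where X = X and f = f, OF s f] by (intro mult_left_mono) (auto simp: m_def)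
    also have "cexp X (\<lambda>\<tau>. f \<tau> * ln (f \<tau> / m \<sigma>)) \<sigma> = cexp X (\<lambda>\<tau>. f \<tau> * ln (f \<tau> / m \<tau>)) \<sigma>"
      using meq by (intro cexp_cong) auto
    finally have *: "cexp X (\<lambda>\<tau>. f \<tau> * ln (k \<tau> / m \<tau>)) \<sigma>
       \<le> inverse (m \<sigma>) * (\<epsilon> * (4 * m \<sigma> * cexp X (\<lambda>\<tau>. f \<tau> * ln (f \<tau> / m \<tau>)) \<sigma>))"
      using m0[OF s] by (simp add: mult_left_mono)
    have E0: "0 \<le> cexp X (\<lambda>\<tau>. f \<tau> * ln (f \<tau> / m \<tau>)) \<sigma>"
      using hellinger_ent[where f = f and X = X, OF s order_refl f]
        cexp_nonneg[OF s, of "\<lambda>\<tau>. (sqrt (f \<tau>) - sqrt (cexp X f \<tau>))\<^sup>2" X] by (simp add: m_def)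
    show ?thesis
    proof (cases "m \<sigma> = 0")
      case True
      then have "cexp X (\<lambda>\<tau>. f \<tau> * ln (k \<tau> / m \<tau>)) \<sigma> \<le> 0" using * by simp
      also have "0 \<le> 4 * \<epsilon> * cexp X (\<lambda>\<tau>. f \<tau> * ln (f \<tau> / m \<tau>)) \<sigma>" using E0 eps by simp
      finally show ?thesis .
    next
      case False
      then show ?thesis using * by (simp add: field_simps)
    qed
  qed
  have split: "f \<sigma> * ln (f \<sigma> / m \<sigma>) = f \<sigma> * ln (f \<sigma> / h \<sigma>) + f \<sigma> * ln (h \<sigma> / k \<sigma>) + f \<sigma> * ln (k \<sigma> / m \<sigma>)"
    if s: "\<sigma> \<in> \<Omega>" for \<sigma>
    using f[OF s] hp[OF s] kp[OF s] mp[OF s]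
    by (cases "f \<sigma> = 0") (auto simp: ln_div algebra_simps)
  have "ent X f = (\<Sum>\<sigma>\<in>\<Omega>. p \<sigma> * (f \<sigma> * ln (f \<sigma> / h \<sigma>) + f \<sigma> * ln (h \<sigma> / k \<sigma>) + f \<sigma> * ln (k \<sigma> / m \<sigma>)))"
    unfolding ent_def m_def[symmetric] using split by (intro sum.cong) auto
  also have "\<dots> = ent (X \<union> D) f + (\<Sum>\<sigma>\<in>\<Omega>. p \<sigma> * (f \<sigma> * ln (h \<sigma> / k \<sigma>)))
      + (\<Sum>\<sigma>\<in>\<Omega>. p \<sigma> * (f \<sigma> * ln (k \<sigma> / m \<sigma>)))"
    by (simp add: ent_def h_def distrib_left sum.distrib)
  \<comment> \<open>The variational bound with trial function \<open>h\<close>, whose conditional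
    mean given \<open>X \<union> S\<close> is \<open>k\<close>.\<close>
  also have "(\<Sum>\<sigma>\<in>\<Omega>. p \<sigma> * (f \<sigma> * ln (h \<sigma> / k \<sigma>))) \<le> ent (X \<union> S) f"
    unfolding k_def using f h0 hp by (intro ent_variational) auto
  also have "(\<Sum>\<sigma>\<in>\<Omega>. p \<sigma> * (f \<sigma> * ln (k \<sigma> / m \<sigma>)))
      = (\<Sum>\<sigma>\<in>\<Omega>. p \<sigma> * cexp X (\<lambda>\<tau>. f \<tau> * ln (k \<tau> / m \<tau>)) \<sigma>)"
    by (rule sum_cexp[symmetric])
  also have "\<dots> \<le> (\<Sum>\<sigma>\<in>\<Omega>. p \<sigma> * (4 * \<epsilon> * cexp X (\<lambda>\<tau>. f \<tau> * ln (f \<tau> / m \<tau>)) \<sigma>))"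
    using third p_nonneg by (intro sum_mono mult_left_mono) auto
  also have "\<dots> = 4 * \<epsilon> * (\<Sum>\<sigma>\<in>\<Omega>. p \<sigma> * cexp X (\<lambda>\<tau>. f \<tau> * ln (f \<tau> / m \<tau>)) \<sigma>)"
    by (simp add: sum_distrib_left mult_ac)
  also have "\<dots> = 4 * \<epsilon> * ent X f" unfolding m_def ent_eq_cexp[symmetric] ..
  finally show ?thesis by (simp add: algebra_simps)
qed

text \<open>Both sides are sums over pairs \<open>(\<rho>, \<tau>)\<close> from the classes of \<open>\<sigma>\<^sub>1\<close> and \<open>\<sigma>\<^sub>2\<close>
  that agree on \<open>Z\<close>, which are compared term by term.\<close>

lemma cexp_ratio:
  assumes s: "\<sigma>\<^sub>1 \<in> \<Omega>" "\<sigma>\<^sub>2 \<in> \<Omega>"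
    and ratio: "\<And>\<rho> \<tau>. \<rho> \<in> cls Y \<sigma>\<^sub>1 \<Longrightarrow> \<tau> \<in> cls Y \<sigma>\<^sub>2 \<Longrightarrow> agree Z \<rho> \<tau> \<Longrightarrow>
      mass (Y \<union> Z) \<rho> / mass Y \<rho> \<le> c * (mass (Y \<union> Z) \<tau> / mass Y \<tau>)"
    and ex12: "\<And>\<rho>. \<rho> \<in> cls Y \<sigma>\<^sub>1 \<Longrightarrow> \<exists>\<tau>\<in>cls Y \<sigma>\<^sub>2. agree Z \<rho> \<tau>"
    and ex21: "\<And>\<tau>. \<tau> \<in> cls Y \<sigma>\<^sub>2 \<Longrightarrow> \<exists>\<rho>\<in>cls Y \<sigma>\<^sub>1. agree Z \<tau> \<rho>"
    and g: "\<And>\<rho>. \<rho> \<in> \<Omega> \<Longrightarrow> g \<rho> \<ge> 0"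
      "\<And>\<rho> \<tau>. \<rho> \<in> \<Omega> \<Longrightarrow> \<tau> \<in> \<Omega> \<Longrightarrow> agree Z \<rho> \<tau> \<Longrightarrow> g \<rho> = g \<tau>"
  shows "cexp Y g \<sigma>\<^sub>1 \<le> c * cexp Y g \<sigma>\<^sub>2"
proof -
  \<comment> \<open>A nonempty fibre is a whole class of \<open>Y \<union> Z\<close>, so its
    normalised weights sum to 1. Inserting this 1 turns a sum over one class into a sum over
    pairs.\<close>
  have fibre: "(\<Sum>\<tau>\<in>{\<tau>\<in>cls Y b. agree Z \<rho> \<tau>}. p \<tau> / mass (Y \<union> Z) \<tau>) = 1"
    if "\<exists>\<tau>\<in>cls Y b. agree Z \<rho> \<tau>" for b \<rho>
  proof -
    from that obtain \<tau>0 where t: "\<tau>0 \<in> \<Omega>" "agree Y b \<tau>0" "agree Z \<rho> \<tau>0" by auto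
    have e: "{\<tau>\<in>cls Y b. agree Z \<rho> \<tau>} = cls (Y \<union> Z) \<tau>0"
      using t by (auto simp: agree_def)
    have "(\<Sum>\<tau>\<in>cls (Y \<union> Z) \<tau>0. p \<tau> / mass (Y \<union> Z) \<tau>)
        = (\<Sum>\<tau>\<in>cls (Y \<union> Z) \<tau>0. p \<tau> / mass (Y \<union> Z) \<tau>0)"
      by (intro sum.cong refl) (metis in_cls mass_eq)
    also have "\<dots> = mass (Y \<union> Z) \<tau>0 / mass (Y \<union> Z) \<tau>0"
      by (simp only: mass_def sum_divide_distrib)
    finally show ?thesis unfolding e using mass_pos[OF t(1), of "Y \<union> Z"] by simp
  qed
  let ?P = "\<lambda>\<rho>. {\<tau>\<in>cls Y \<sigma>\<^sub>2. agree Z \<rho> \<tau>}" and ?Q = "\<lambda>\<tau>. {\<rho>\<in>cls Y \<sigma>\<^sub>1. agree Z \<rho> \<tau>}"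
  have "cexp Y g \<sigma>\<^sub>1
      = (\<Sum>\<rho>\<in>cls Y \<sigma>\<^sub>1. p \<rho> * g \<rho> / mass Y \<sigma>\<^sub>1 * (\<Sum>\<tau>\<in>?P \<rho>. p \<tau> / mass (Y \<union> Z) \<tau>))"
    unfolding cexp_def sum_divide_distrib
    by (intro sum.cong refl, subst fibre) (use ex12 in auto)
  also have "\<dots> = (\<Sum>\<rho>\<in>cls Y \<sigma>\<^sub>1. \<Sum>\<tau>\<in>?P \<rho>. p \<rho> * g \<rho> / mass Y \<sigma>\<^sub>1 * (p \<tau> / mass (Y \<union> Z) \<tau>))"
    by (simp only: sum_distrib_left)
  also have "\<dots> \<le> (\<Sum>\<rho>\<in>cls Y \<sigma>\<^sub>1. \<Sum>\<tau>\<in>?P \<rho>. c * (p \<tau> * g \<tau> / mass Y \<sigma>\<^sub>2 * (p \<rho> / mass (Y \<union> Z) \<rho>)))"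
  proof (intro sum_mono)
    fix \<rho> \<tau> assume r: "\<rho> \<in> cls Y \<sigma>\<^sub>1" and t: "\<tau> \<in> ?P \<rho>"
    have m: "mass Y \<sigma>\<^sub>1 = mass Y \<rho>" "mass Y \<sigma>\<^sub>2 = mass Y \<tau>"
      using r t by (auto intro: mass_eq)
    have rt: "\<rho> \<in> \<Omega>" "\<tau> \<in> \<Omega>" "agree Z \<rho> \<tau>" using r t by auto
    have pos: "mass Y \<rho> > 0" "mass Y \<tau> > 0" "mass (Y \<union> Z) \<rho> > 0" "mass (Y \<union> Z) \<tau> > 0"
      using rt by (auto intro: mass_pos)
    have "g \<rho> = g \<tau>" using rt by (rule g(2))
    have "mass (Y \<union> Z) \<rho> * mass Y \<tau> \<le> c * mass (Y \<union> Z) \<tau> * mass Y \<rho>"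
      using ratio[OF r _ rt(3)] t pos by (simp add: field_simps)
    then have "1 / (mass Y \<rho> * mass (Y \<union> Z) \<tau>) \<le> c / (mass Y \<tau> * mass (Y \<union> Z) \<rho>)"
      using pos by (simp add: field_simps)
    then have "p \<rho> * p \<tau> * g \<tau> * (1 / (mass Y \<rho> * mass (Y \<union> Z) \<tau>))
        \<le> p \<rho> * p \<tau> * g \<tau> * (c / (mass Y \<tau> * mass (Y \<union> Z) \<rho>))"
      using rt g(1) p_nonneg by (intro mult_left_mono) auto
    then show "p \<rho> * g \<rho> / mass Y \<sigma>\<^sub>1 * (p \<tau> / mass (Y \<union> Z) \<tau>)
        \<le> c * (p \<tau> * g \<tau> / mass Y \<sigma>\<^sub>2 * (p \<rho> / mass (Y \<union> Z) \<rho>))"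
      unfolding m \<open>g \<rho> = g \<tau>\<close> by (simp add: mult_ac)
  qed
  also have "\<dots> = (\<Sum>\<tau>\<in>cls Y \<sigma>\<^sub>2. \<Sum>\<rho>\<in>?Q \<tau>. c * (p \<tau> * g \<tau> / mass Y \<sigma>\<^sub>2 * (p \<rho> / mass (Y \<union> Z) \<rho>)))"
    by (rule sum.swap_restrict) auto
  also have "\<dots> = (\<Sum>\<tau>\<in>cls Y \<sigma>\<^sub>2. c * (p \<tau> * g \<tau> / mass Y \<sigma>\<^sub>2 * (\<Sum>\<rho>\<in>?Q \<tau>. p \<rho> / mass (Y \<union> Z) \<rho>)))"
    by (simp only: sum_distrib_left)
  also have "\<dots> = (\<Sum>\<tau>\<in>cls Y \<sigma>\<^sub>2. c * (p \<tau> * g \<tau> / mass Y \<sigma>\<^sub>2))"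
  proof (intro sum.cong refl)
    fix \<tau> assume t: "\<tau> \<in> cls Y \<sigma>\<^sub>2"
    have "?Q \<tau> = {\<rho>\<in>cls Y \<sigma>\<^sub>1. agree Z \<tau> \<rho>}" by (auto simp: agree_def)
    with fibre[OF ex21[OF t]]
    show "c * (p \<tau> * g \<tau> / mass Y \<sigma>\<^sub>2 * (\<Sum>\<rho>\<in>?Q \<tau>. p \<rho> / mass (Y \<union> Z) \<rho>)) = c * (p \<tau> * g \<tau> / mass Y \<sigma>\<^sub>2)"
      by simp
  qed
  also have "\<dots> = c * cexp Y g \<sigma>\<^sub>2"
    by (simp add: cexp_def sum_distrib_left sum_divide_distrib)
  finally show ?thesis .
qed

text \<open>\<open>cexp X g\<close> averages \<open>cexp (X \<union> S) g\<close> over the class of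
  \<open>\<sigma>\<close>. If these values agree up to a factor \<open>1 + \<epsilon>\<close>, each
  is within a relative error \<open>\<epsilon>\<close> of their average. This argument wants
  \<open>g\<close> nonnegative; a signed \<open>g\<close> is split into its positive and negative
  parts, whose means add up to that of the absolute value.\<close>

lemma cexp_near:
  assumes s: "\<sigma> \<in> \<Omega>" and eps: "\<epsilon> \<ge> 0"
    and ratio: "\<And>g \<sigma>\<^sub>1 \<sigma>\<^sub>2. \<sigma>\<^sub>1 \<in> \<Omega> \<Longrightarrow> \<sigma>\<^sub>2 \<in> \<Omega> \<Longrightarrow> agree X \<sigma>\<^sub>1 \<sigma>\<^sub>2 \<Longrightarrow> (\<And>\<rho>. \<rho> \<in> \<Omega> \<Longrightarrow> g \<rho> \<ge> 0) \<Longrightarrow>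
      (\<And>\<rho> \<tau>. \<rho> \<in> \<Omega> \<Longrightarrow> \<tau> \<in> \<Omega> \<Longrightarrow> agree Z \<rho> \<tau> \<Longrightarrow> g \<rho> = g \<tau>) \<Longrightarrow>
      cexp (X \<union> S) g \<sigma>\<^sub>1 \<le> (1 + \<epsilon>) * cexp (X \<union> S) g \<sigma>\<^sub>2"
    and g: "\<And>\<rho> \<tau>. \<rho> \<in> \<Omega> \<Longrightarrow> \<tau> \<in> \<Omega> \<Longrightarrow> agree Z \<rho> \<tau> \<Longrightarrow> g \<rho> = g \<tau>"
  shows "\<bar>cexp (X \<union> S) g \<sigma> - cexp X g \<sigma>\<bar> \<le> \<epsilon> * cexp X (\<lambda>\<tau>. \<bar>g \<tau>\<bar>) \<sigma>"
proof -
  have near: "\<bar>cexp (X \<union> S) h \<sigma> - cexp X h \<sigma>\<bar> \<le> \<epsilon> * cexp X h \<sigma>"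
    if h: "\<And>\<rho>. \<rho> \<in> \<Omega> \<Longrightarrow> h \<rho> \<ge> 0"
      "\<And>\<rho> \<tau>. \<rho> \<in> \<Omega> \<Longrightarrow> \<tau> \<in> \<Omega> \<Longrightarrow> agree Z \<rho> \<tau> \<Longrightarrow> h \<rho> = h \<tau>" for h
  proof -
    let ?k = "cexp (X \<union> S) h"
    have t: "cexp X ?k \<sigma> = cexp X h \<sigma>" using s by (intro cexp_tower) auto
    have "cexp X (\<lambda>_. ?k \<sigma>) \<sigma> \<le> cexp X (\<lambda>\<tau>. (1 + \<epsilon>) * ?k \<tau>) \<sigma>"
      by (intro cexp_mono s ratio) (assumption | rule h | erule (2) h(2))+
    then have 1: "?k \<sigma> \<le> (1 + \<epsilon>) * cexp X h \<sigma>" using s by (simp add: cexp_const cexp_cmult t)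
    have "cexp X ?k \<sigma> \<le> cexp X (\<lambda>_. (1 + \<epsilon>) * ?k \<sigma>) \<sigma>"
      by (intro cexp_mono s ratio) (assumption | erule agree_sym | rule s h(1) | erule (2) h(2))+
    then have 2: "cexp X h \<sigma> \<le> (1 + \<epsilon>) * ?k \<sigma>" using s by (simp add: cexp_const t)
    have "cexp X h \<sigma> \<ge> 0" "?k \<sigma> \<ge> 0" using s h(1) by (auto intro: cexp_nonneg)
    \<comment> \<open>Fact \<open>2\<close> gives the error \<open>\<epsilon> * ?k \<sigma>\<close>,
      but \<open>\<epsilon> * cexp X h \<sigma>\<close> is wanted. If \<open>?k \<sigma>\<close> is
      the larger mean, the difference to be bounded is not positive anyway.\<close>
    have "\<epsilon> * ?k \<sigma> \<le> \<epsilon> * cexp X h \<sigma> \<or> ?k \<sigma> \<ge> cexp X h \<sigma>"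
      using eps by (metis linear mult_left_mono)
    then have "cexp X h \<sigma> - ?k \<sigma> \<le> \<epsilon> * cexp X h \<sigma>"
    proof
      assume "\<epsilon> * ?k \<sigma> \<le> \<epsilon> * cexp X h \<sigma>"
      then show ?thesis using 2 by (simp add: algebra_simps)
    next
      assume "?k \<sigma> \<ge> cexp X h \<sigma>"
      moreover have "\<epsilon> * cexp X h \<sigma> \<ge> 0" using eps \<open>cexp X h \<sigma> \<ge> 0\<close> by simp
      ultimately show ?thesis by linarith
    qed
    then show ?thesis using 1 by (simp add: algebra_simps abs_le_iff)
  qed
  let ?p = "\<lambda>\<tau>. max (g \<tau>) 0" and ?n = "\<lambda>\<tau>. max (- g \<tau>) 0"
  have e1: "cexp Y g \<sigma> = cexp Y ?p \<sigma> - cexp Y ?n \<sigma>" for Y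
    unfolding cexp_diff[symmetric] by (intro cexp_cong) (auto simp: max_def)
  have e2: "cexp X (\<lambda>\<tau>. \<bar>g \<tau>\<bar>) \<sigma> = cexp X ?p \<sigma> + cexp X ?n \<sigma>"
    unfolding cexp_add[symmetric] by (intro cexp_cong) (auto simp: max_def)
  have "\<bar>cexp (X \<union> S) ?p \<sigma> - cexp X ?p \<sigma>\<bar> \<le> \<epsilon> * cexp X ?p \<sigma>"
    by (rule near, simp, metis g)
  moreover have "\<bar>cexp (X \<union> S) ?n \<sigma> - cexp X ?n \<sigma>\<bar> \<le> \<epsilon> * cexp X ?n \<sigma>"
    by (rule near, simp, metis g)
  ultimately show ?thesis unfolding e1 e2 by (simp add: distrib_left)
qed

section \<open>Entropy and the oscillation of the square root\<close>

text \<open>\<open>\<tau>\<close> and \<open>\<tau>'\<close> share the value of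
  \<open>cexp Y f\<close>, and the distances of \<open>sqrt (f \<tau>)\<close> and
  \<open>sqrt (f \<tau>')\<close> to its root are two single terms of the Hellinger bound. With
  \<open>Y\<close> the complement of a vertex this prices a single spin change.\<close>

lemma sqrt_le_ent:
  assumes f: "\<And>\<tau>. \<tau> \<in> \<Omega> \<Longrightarrow> f \<tau> \<ge> 0" and s: "\<sigma> \<in> \<Omega>" and XY: "X \<subseteq> Y"
    and \<tau>: "\<tau> \<in> cls X \<sigma>" and \<tau>': "\<tau>' \<in> cls X \<sigma>" and agr: "agree Y \<tau> \<tau>'"
    and r: "r > 0" "p \<tau> / mass X \<sigma> \<ge> r" "p \<tau>' / mass X \<sigma> \<ge> r"
  shows "r * (sqrt (f \<tau>) - sqrt (f \<tau>'))\<^sup>2 \<le> 2 * cexp X (\<lambda>\<tau>. f \<tau> * ln (f \<tau> / cexp Y f \<tau>)) \<sigma>"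
proof (cases "\<tau> = \<tau>'")
  case True
  have "0 \<le> cexp X (\<lambda>\<tau>. f \<tau> * ln (f \<tau> / cexp Y f \<tau>)) \<sigma>"
    using hellinger_ent[where f = f and X = X and Y = Y, OF s XY f]
      cexp_nonneg[OF s, of "\<lambda>\<tau>. (sqrt (f \<tau>) - sqrt (cexp Y f \<tau>))\<^sup>2" X] by auto
  then show ?thesis using True by simp
next
  case False
  define h where "h \<rho> = (sqrt (f \<rho>) - sqrt (cexp Y f \<rho>))\<^sup>2" for \<rho>
  have "sqrt (cexp Y f \<tau>') = sqrt (cexp Y f \<tau>)" using cexp_eq[OF agr] by simp
  then have "(sqrt (f \<tau>) - sqrt (f \<tau>'))\<^sup>2 \<le> 2 * (h \<tau> + h \<tau>')"
  proof -
    have "0 \<le> ((sqrt (f \<tau>) - sqrt (cexp Y f \<tau>)) + (sqrt (f \<tau>') - sqrt (cexp Y f \<tau>)))\<^sup>2" by simp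
    then show ?thesis unfolding h_def \<open>sqrt (cexp Y f \<tau>') = _\<close>
      by (simp add: power2_eq_square algebra_simps)
  qed
  then have "r * (sqrt (f \<tau>) - sqrt (f \<tau>'))\<^sup>2 \<le> r * (2 * (h \<tau> + h \<tau>'))"
    using r by (intro mult_left_mono) auto
  also have "\<dots> \<le> 2 * (p \<tau> / mass X \<sigma> * h \<tau> + p \<tau>' / mass X \<sigma> * h \<tau>')"
  proof -
    have "r * h \<tau> \<le> p \<tau> / mass X \<sigma> * h \<tau>" by (rule mult_right_mono[OF r(2)]) (simp add: h_def)
    moreover have "r * h \<tau>' \<le> p \<tau>' / mass X \<sigma> * h \<tau>'"
      by (rule mult_right_mono[OF r(3)]) (simp add: h_def)
    ultimately have "2 * (r * h \<tau> + r * h \<tau>') \<le> 2 * (p \<tau> / mass X \<sigma> * h \<tau> + p \<tau>' / mass X \<sigma> * h \<tau>')"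
      by (intro mult_left_mono add_mono) auto
    then show ?thesis by (simp only: distrib_left mult.left_commute)
  qed
  also have "p \<tau> / mass X \<sigma> * h \<tau> + p \<tau>' / mass X \<sigma> * h \<tau>' = (\<Sum>\<rho>\<in>{\<tau>, \<tau>'}. p \<rho> * h \<rho>) / mass X \<sigma>"
    using False by (simp add: add_divide_distrib)
  also have "\<dots> \<le> cexp X h \<sigma>" unfolding cexp_def
    using \<tau> \<tau>' mass_pos[OF s, of X]
    by (intro divide_right_mono sum_mono2) (auto simp: h_def p_nonneg)
  also have "\<dots> \<le> cexp X (\<lambda>\<tau>. f \<tau> * ln (f \<tau> / cexp Y f \<tau>)) \<sigma>"
    unfolding h_def by (rule hellinger_ent[OF s XY f])
  finally show ?thesis by simp
qed

text \<open>The entropy is at most the mean of f ln (f / M) - f + M for every M > 0. With the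
  maximum of \<open>f\<close> for M this is at most the mean of (M - f)^2 / M, and the division is
  harmless because (sqrt M + sqrt f)^2 \<le> 4 M.\<close>

lemma ent_le_sqrt_osc:
  assumes f: "\<And>\<tau>. \<tau> \<in> \<Omega> \<Longrightarrow> f \<tau> \<ge> 0" and s: "\<sigma> \<in> \<Omega>"
    and osc: "\<And>\<tau> \<tau>'. \<tau> \<in> cls X \<sigma> \<Longrightarrow> \<tau>' \<in> cls X \<sigma> \<Longrightarrow> \<bar>sqrt (f \<tau>) - sqrt (f \<tau>')\<bar> \<le> b"
  shows "cexp X (\<lambda>\<tau>. f \<tau> * ln (f \<tau> / cexp X f \<tau>)) \<sigma> \<le> 4 * b\<^sup>2"
proof -
  define m where "m = cexp X f \<sigma>"
  define M where "M = Max (f ` cls X \<sigma>)"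
  have "\<sigma> \<in> cls X \<sigma>" using s by simp
  then have ne: "f ` cls X \<sigma> \<noteq> {}" by blast
  have "M \<in> f ` cls X \<sigma>" unfolding M_def using ne by (intro Max_in) auto
  then obtain \<tau>0 where t0: "\<tau>0 \<in> cls X \<sigma>" "f \<tau>0 = M" by auto
  have le: "f \<tau> \<le> M" if "\<tau> \<in> cls X \<sigma>" for \<tau> unfolding M_def using that by (intro Max_ge) auto
  have e: "cexp X (\<lambda>\<tau>. f \<tau> * ln (f \<tau> / cexp X f \<tau>)) \<sigma> = cexp X (\<lambda>\<tau>. f \<tau> * ln (f \<tau> / m)) \<sigma>"
    unfolding m_def by (intro cexp_cong) (metis cexp_eq)
  show ?thesis
  proof (cases "M > 0")
    case False
    then have "f \<tau> = 0" if "\<tau> \<in> cls X \<sigma>" for \<tau> using le[OF that] f that by force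
    then have "cexp X (\<lambda>\<tau>. f \<tau> * ln (f \<tau> / m)) \<sigma> = cexp X (\<lambda>_. 0) \<sigma>"
      by (intro cexp_cong) auto
    then show ?thesis unfolding e using s by (simp add: cexp_const)
  next
    case True
    have mpos: "m > 0"
    proof -
      have "cexp X f \<tau>0 > 0" using t0 True f by (intro cexp_pos) auto
      then show ?thesis using t0 cexp_eq[of X \<sigma> \<tau>0] by (simp add: m_def)
    qed
    have "m * ln (M / m) \<le> M - m" using mpos True by (intro ent_term_le) auto
    have "cexp X (\<lambda>\<tau>. f \<tau> * ln (f \<tau> / m)) \<sigma> = cexp X (\<lambda>\<tau>. f \<tau> * ln (f \<tau> / M) + ln (M / m) * f \<tau>) \<sigma>"
      using f mpos True by (intro cexp_cong) (auto simp: ln_div algebra_simps)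
    also have "\<dots> = cexp X (\<lambda>\<tau>. f \<tau> * ln (f \<tau> / M)) \<sigma> + ln (M / m) * m"
      by (simp add: cexp_add cexp_cmult m_def)
    also have "\<dots> \<le> cexp X (\<lambda>\<tau>. f \<tau> * ln (f \<tau> / M)) \<sigma> + (M - m)"
      using \<open>m * ln (M / m) \<le> M - m\<close> by (simp add: mult.commute)
    also have "\<dots> = cexp X (\<lambda>\<tau>. f \<tau> * ln (f \<tau> / M) - f \<tau> + M) \<sigma>"
      using s by (simp add: cexp_add cexp_diff cexp_const m_def)
    also have "\<dots> \<le> cexp X (\<lambda>_. 4 * b\<^sup>2) \<sigma>"
    proof (rule cexp_mono[OF s])
      fix \<tau> assume t: "\<tau> \<in> \<Omega>" "agree X \<sigma> \<tau>"
      then have f0: "0 \<le> f \<tau>" and fM: "f \<tau> \<le> M" using f le by auto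
      have "f \<tau> * ln (f \<tau> / M) \<le> f \<tau> * (f \<tau> / M - 1)"
        using f0 True by (cases "f \<tau> = 0") (auto intro!: mult_left_mono ln_le_minus_one)
      then have "f \<tau> * ln (f \<tau> / M) - f \<tau> + M \<le> (M - f \<tau>)\<^sup>2 / M"
        using True by (simp add: field_simps power2_eq_square)
      also have "(M - f \<tau>)\<^sup>2 = (sqrt M - sqrt (f \<tau>))\<^sup>2 * (sqrt M + sqrt (f \<tau>))\<^sup>2"
      proof -
        have "M - f \<tau> = (sqrt M - sqrt (f \<tau>)) * (sqrt M + sqrt (f \<tau>))"
          using f0 True by (simp add: algebra_simps)
        then show ?thesis by (simp add: power_mult_distrib)
      qed
      also have "\<dots> \<le> b\<^sup>2 * (2 * sqrt M)\<^sup>2"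
      proof (intro mult_mono)
        have "\<bar>sqrt M - sqrt (f \<tau>)\<bar> \<le> b" using osc[OF t0(1), of \<tau>] t0(2) t by auto
        then have "\<bar>sqrt M - sqrt (f \<tau>)\<bar> \<le> \<bar>b\<bar>" by linarith
        then show "(sqrt M - sqrt (f \<tau>))\<^sup>2 \<le> b\<^sup>2" by (simp only: abs_le_square_iff)
        show "(sqrt M + sqrt (f \<tau>))\<^sup>2 \<le> (2 * sqrt M)\<^sup>2"
          using f0 fM True by (intro power_mono) auto
      qed auto
      also have "\<dots> = 4 * b\<^sup>2 * M" using True by (simp add: power_mult_distrib)
      finally show "f \<tau> * ln (f \<tau> / M) - f \<tau> + M \<le> 4 * b\<^sup>2"
        using True by (simp add: divide_right_mono)
    qed
    also have "\<dots> = 4 * b\<^sup>2" using s by (rule cexp_const)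
    finally show ?thesis unfolding e .
  qed
qed

section \<open>Entropy under averaging\<close>

lemma ent_cong:
  assumes "\<And>\<tau>. \<tau> \<in> \<Omega> \<Longrightarrow> f \<tau> = g \<tau>"
  shows "ent X f = ent X g"
proof -
  have "cexp X f \<sigma> = cexp X g \<sigma>" for \<sigma> by (rule cexp_cong) (rule assms)
  then show ?thesis unfolding ent_def using assms by (intro sum.cong) auto
qed

text \<open>The chain rule: ln (f / m) = ln (f / F) + ln (F / m), where the last term is determined
  by the spins in \<open>Y\<close>, so under the mean its factor \<open>f\<close> may be replaced by
  \<open>F\<close>. This is the exact loss of entropy when all spins outside \<open>Y\<close> are
  resampled.\<close>

lemma ent_cexp:
  assumes f: "\<And>\<tau>. \<tau> \<in> \<Omega> \<Longrightarrow> f \<tau> \<ge> 0"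
  shows "ent {} (cexp Y f) = ent {} f - ent Y f"
proof -
  define F where "F = cexp Y f"
  define m where "m = cexp {} f"
  have meq: "m \<sigma> = m \<tau>" for \<sigma> \<tau> by (simp add: m_def cexp_def mass_def)
  have mF: "cexp {} F \<sigma> = m \<sigma>" if "\<sigma> \<in> \<Omega>" for \<sigma>
    unfolding F_def m_def using that by (intro cexp_tower) auto
  have "ent {} F = (\<Sum>\<sigma>\<in>\<Omega>. p \<sigma> * (ln (F \<sigma> / m \<sigma>) * F \<sigma>))"
    unfolding ent_def using mF by (intro sum.cong) (auto simp: mult_ac)
  also have "\<dots> = (\<Sum>\<sigma>\<in>\<Omega>. p \<sigma> * cexp Y (\<lambda>\<tau>. ln (F \<tau> / m \<tau>) * f \<tau>) \<sigma>)"
  proof (intro sum.cong refl arg_cong2[of _ _ _ _ "(*)"])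
    fix \<sigma> show "ln (F \<sigma> / m \<sigma>) * F \<sigma> = cexp Y (\<lambda>\<tau>. ln (F \<tau> / m \<tau>) * f \<tau>) \<sigma>"
      unfolding F_def by (rule cexp_pull[symmetric]) (metis cexp_eq meq)
  qed
  also have "\<dots> = (\<Sum>\<sigma>\<in>\<Omega>. p \<sigma> * (ln (F \<sigma> / m \<sigma>) * f \<sigma>))" by (rule sum_cexp)
  also have "\<dots> = (\<Sum>\<sigma>\<in>\<Omega>. p \<sigma> * (f \<sigma> * ln (f \<sigma> / m \<sigma>)) - p \<sigma> * (f \<sigma> * ln (f \<sigma> / F \<sigma>)))"
  proof (intro sum.cong refl)
    fix \<sigma> assume s: "\<sigma> \<in> \<Omega>"
    show "p \<sigma> * (ln (F \<sigma> / m \<sigma>) * f \<sigma>) = p \<sigma> * (f \<sigma> * ln (f \<sigma> / m \<sigma>)) - p \<sigma> * (f \<sigma> * ln (f \<sigma> / F \<sigma>))"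
    proof (cases "f \<sigma> = 0")
      case False
      then have "f \<sigma> > 0" using f[OF s] by simp
      then have "F \<sigma> > 0" "m \<sigma> > 0" unfolding F_def m_def using s f by (auto intro: cexp_pos)
      then show ?thesis using \<open>f \<sigma> > 0\<close> by (simp add: ln_div algebra_simps)
    qed simp
  qed
  also have "\<dots> = ent {} f - ent Y f" by (simp add: ent_def F_def m_def sum_subtractf)
  finally show ?thesis unfolding F_def .
qed

text \<open>Convexity of entropy. As the means coincide, the logarithms have a common denominator,
  and it remains to use the convexity of x ln x at each configuration.\<close>

lemma ent_mean_le:
  assumes I: "finite I" "I \<noteq> {}" and g: "\<And>i \<tau>. i \<in> I \<Longrightarrow> \<tau> \<in> \<Omega> \<Longrightarrow> g i \<tau> \<ge> 0"
    and m: "\<And>i \<tau>. i \<in> I \<Longrightarrow> \<tau> \<in> \<Omega> \<Longrightarrow> cexp {} (g i) \<tau> = m"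
  shows "ent {} (\<lambda>\<tau>. (\<Sum>i\<in>I. g i \<tau>) / card I) \<le> (\<Sum>i\<in>I. ent {} (g i)) / card I"
proof -
  define G where "G \<tau> = (\<Sum>i\<in>I. g i \<tau>) / card I" for \<tau>
  have n: "real (card I) > 0" using I by (simp add: card_gt_0_iff)
  have mG: "cexp {} G \<tau> = m" if t: "\<tau> \<in> \<Omega>" for \<tau>
  proof -
    have "cexp {} G \<tau> = (\<Sum>i\<in>I. cexp {} (g i) \<tau>) / card I"
      unfolding G_def cexp_def sum_divide_distrib sum_distrib_left
      by (subst sum.swap) (simp add: mult_ac)
    also have "\<dots> = m" using m[OF _ t] n by simp
    finally show ?thesis .
  qed
  have "card I * (G \<tau> * ln (G \<tau> / m)) \<le> (\<Sum>i\<in>I. g i \<tau> * ln (g i \<tau> / m))" if t: "\<tau> \<in> \<Omega>" for \<tau>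
  proof -
    have nG: "card I * G \<tau> = (\<Sum>i\<in>I. g i \<tau>)" unfolding G_def using n by simp
    have G0: "G \<tau> \<ge> 0" unfolding G_def using g t by (intro divide_nonneg_nonneg sum_nonneg) auto
    have pos: "G \<tau> > 0 \<and> m > 0" if i: "i \<in> I" "g i \<tau> > 0" for i
    proof
      have "(\<Sum>i\<in>I. g i \<tau>) > 0" using i I g t by (intro sum_pos2[of I i]) auto
      then show "G \<tau> > 0" unfolding G_def using n by simp
      have "cexp {} (g i) \<tau> > 0" using t i g by (intro cexp_pos) auto
      then show "m > 0" using m t i by simp
    qed
    have "(\<Sum>i\<in>I. g i \<tau> * ln (G \<tau> / m)) - (\<Sum>i\<in>I. g i \<tau> * ln (g i \<tau> / m))
        = (\<Sum>i\<in>I. g i \<tau> * ln (G \<tau> / g i \<tau>))"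
      unfolding sum_subtractf[symmetric]
    proof (intro sum.cong refl)
      fix i assume i: "i \<in> I"
      show "g i \<tau> * ln (G \<tau> / m) - g i \<tau> * ln (g i \<tau> / m) = g i \<tau> * ln (G \<tau> / g i \<tau>)"
      proof (cases "g i \<tau> = 0")
        case False
        then have "g i \<tau> > 0" using g i t by (metis less_eq_real_def)
        then show ?thesis using pos[OF i] by (simp add: ln_div algebra_simps)
      qed simp
    qed
    also have "\<dots> \<le> (\<Sum>i\<in>I. G \<tau> - g i \<tau>)"
      using g t G0 pos by (intro sum_mono ent_term_le) auto
    also have "\<dots> = 0" using nG by (simp add: sum_subtractf)
    finally show ?thesis unfolding nG mult.assoc[symmetric] by (simp add: sum_distrib_right)
  qed
  then have "(\<Sum>\<tau>\<in>\<Omega>. p \<tau> * (card I * (G \<tau> * ln (G \<tau> / m)))) \<le> (\<Sum>\<tau>\<in>\<Omega>. p \<tau> * (\<Sum>i\<in>I. g i \<tau> * ln (g i \<tau> / m)))"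
    using p_nonneg by (intro sum_mono mult_left_mono) auto
  also have "\<dots> = (\<Sum>i\<in>I. ent {} (g i))"
    unfolding ent_def sum_distrib_left by (subst sum.swap) (auto intro!: sum.cong simp: m)
  also have "(\<Sum>\<tau>\<in>\<Omega>. p \<tau> * (card I * (G \<tau> * ln (G \<tau> / m)))) = card I * ent {} G"
    unfolding ent_def sum_distrib_left using mG by (intro sum.cong) (auto simp: mult_ac)
  finally show ?thesis using n unfolding G_def by (simp add: field_simps)
qed

end

section \<open>Spatial mixing in the hardcore model\<close>

lemma graph_dist_self [simp]: "graph_dist E v v = 0"
proof -
  have "graph_dist E v v \<le> enat 0" unfolding graph_dist_def by (intro Inf_lower) auto
  then show ?thesis by (simp add: enat_0)
qed

lemma graph_dist_edge: "{u, v} \<in> E \<Longrightarrow> graph_dist E u v \<le> 1"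
  unfolding graph_dist_def one_enat_def by (intro Inf_lower image_eqI[of _ _ 1]) auto

lemma graph_dist_triangle: "graph_dist E u w \<le> graph_dist E u v + graph_dist E v w"
proof -
  let ?R = "{(x, y). {x, y} \<in> E}"
  \<comment> \<open>A finite infimum of naturals is attained, so there are shortest walks to
    concatenate.\<close>
  have att: "\<exists>k. Inf (enat ` K) = enat k \<and> k \<in> K" if "Inf (enat ` K) \<noteq> \<infinity>" for K :: "nat set"
  proof -
    have "enat ` K \<noteq> {}" using that by (auto simp: Inf_enat_def)
    then have "Inf (enat ` K) \<in> enat ` K" using Inf_enat_def wellorder_InfI by (metis all_not_in_conv)
    then show ?thesis by auto
  qed
  show ?thesis
  proof (cases "graph_dist E u v = \<infinity> \<or> graph_dist E v w = \<infinity>")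
    case False
    then obtain i j where i: "graph_dist E u v = enat i" "(u, v) \<in> ?R ^^ i"
      and j: "graph_dist E v w = enat j" "(v, w) \<in> ?R ^^ j"
      using att[of "{k. (u, v) \<in> ?R ^^ k}"] att[of "{k. (v, w) \<in> ?R ^^ k}"]
      unfolding graph_dist_def by auto
    have "(u, w) \<in> ?R ^^ (i + j)" using i j by (auto simp: relpow_add)
    then have "graph_dist E u w \<le> enat (i + j)"
      unfolding graph_dist_def by (intro Inf_lower) auto
    then show ?thesis using i j by simp
  qed auto
qed

lemma power_enat_antimono:
  assumes "0 \<le> x" "x \<le> 1" "enat r \<le> k"
  shows "power_enat x k \<le> x ^ r"
  using assms by (cases k) (auto simp: power_enat_def intro: power_decreasing)

lemma one_plus_power_le:
  fixes \<kappa> :: real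
  assumes "\<kappa> \<ge> 0" "real n * \<kappa> \<le> 1"
  shows "(1 + \<kappa>) ^ n \<le> 1 + 2 * (real n * \<kappa>)"
proof -
  have "(1 + \<kappa>) ^ n \<le> exp \<kappa> ^ n" using assms by (intro power_mono) (auto intro: exp_ge_add_one_self)
  also have "\<dots> = exp (real n * \<kappa>)" by (simp add: exp_of_nat_mult)
  also have "\<dots> \<le> 1 + real n * \<kappa> + (real n * \<kappa>)\<^sup>2" using assms by (intro exp_bound) auto
  also have "(real n * \<kappa>)\<^sup>2 \<le> real n * \<kappa>"
    using assms by (simp add: power2_eq_square mult_left_le_one_le)
  finally show ?thesis by (simp add: algebra_simps)
qed

section \<open>The support of the hardcore distribution\<close>

locale hardcore_model =
  fixes V :: "'a set" and E :: "'a set set" and l :: real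
  assumes graph: "simple_graph V E" and l_pos: "l > 0"
begin

abbreviation "\<mu> \<equiv> hardcore V E l"

lemma finite_V [simp]: "finite V"
  using graph by (simp add: simple_graph_def)

lemma set_hardcore:
  "set_pmf \<mu> = {\<sigma> \<in> V \<rightarrow>\<^sub>E {0, 1}. independent_set V E {v\<in>V. \<sigma> v = 1}}"
  using hardcore_partition_pos[OF graph l_pos] l_pos
  by (auto simp: set_pmf_eq pmf_hardcore[OF graph l_pos] hardcore_weight_def)

lemma finite_set_hardcore: "finite (set_pmf \<mu>)"
  by (rule finite_subset[of _ "V \<rightarrow>\<^sub>E {0, 1}"]) (auto simp: set_hardcore intro!: finite_PiE)

sublocale weighted_configs "set_pmf \<mu>" "pmf \<mu>"
  by unfold_locales (auto simp: finite_set_hardcore pmf_positive_iff)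

lemma hardcoreI:
  assumes "\<And>v. v \<in> V \<Longrightarrow> \<sigma> v = 0 \<or> \<sigma> v = 1" "\<And>v. v \<notin> V \<Longrightarrow> \<sigma> v = undefined"
    and "\<And>u v. {u, v} \<in> E \<Longrightarrow> u \<noteq> v \<Longrightarrow> \<sigma> u = 1 \<Longrightarrow> \<sigma> v \<noteq> 1"
  shows "\<sigma> \<in> set_pmf \<mu>"
proof -
  have "\<not> e \<subseteq> {v\<in>V. \<sigma> v = 1}" if "e \<in> E" for e
  proof -
    have "e \<subseteq> V" "card e = 2" using that graph by (auto simp: simple_graph_def)
    then obtain u v where e: "e = {u, v}" "u \<noteq> v" by (auto simp: card_2_iff)
    then show ?thesis using assms(3)[of u v] that by auto
  qed
  then show ?thesis using assms(1,2) by (auto simp: set_hardcore independent_set_def PiE_def extensional_def)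
qed

lemma hardcoreD:
  assumes "\<sigma> \<in> set_pmf \<mu>"
  shows "v \<in> V \<Longrightarrow> \<sigma> v = 0 \<or> \<sigma> v = 1" "v \<notin> V \<Longrightarrow> \<sigma> v = undefined"
    and "{u, v} \<in> E \<Longrightarrow> \<sigma> u = 1 \<Longrightarrow> \<sigma> v \<noteq> 1"
proof -
  show "v \<in> V \<Longrightarrow> \<sigma> v = 0 \<or> \<sigma> v = 1" "v \<notin> V \<Longrightarrow> \<sigma> v = undefined"
    using assms by (auto simp: set_hardcore)
  assume e: "{u, v} \<in> E" "\<sigma> u = 1"
  then have "{u, v} \<subseteq> V" using graph by (auto simp: simple_graph_def)
  then show "\<sigma> v \<noteq> 1" using assms e by (auto simp: set_hardcore independent_set_def)
qed

text \<open>Emptying vertices preserves independence, so any configuration can be emptied one vertex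
  at a time without leaving the support. This gives paths between configurations despite the hard
  constraints.\<close>

definition clear :: "'a set \<Rightarrow> ('a \<Rightarrow> nat) \<Rightarrow> 'a \<Rightarrow> nat" where
  "clear T \<sigma> = (\<lambda>x. if x \<in> T then 0 else \<sigma> x)"

lemma clear_hardcore: "\<sigma> \<in> set_pmf \<mu> \<Longrightarrow> T \<subseteq> V \<Longrightarrow> clear T \<sigma> \<in> set_pmf \<mu>"
  by (intro hardcoreI) (auto simp: clear_def dest: hardcoreD split: if_splits)

text \<open>Vertices outside \<open>X\<close>, \<open>D\<close> and \<open>S\<close> are left empty,
  so a conflict could arise only along an edge between \<open>D\<close> and \<open>S\<close>, and
  there is none. This supplies the nonempty fibres for comparing two boundary conditions.\<close>

lemma ex_hardcore_glue:
  assumes s: "\<sigma>\<^sub>1 \<in> set_pmf \<mu>" "\<sigma>\<^sub>2 \<in> set_pmf \<mu>" "agree X \<sigma>\<^sub>1 \<sigma>\<^sub>2"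
    and nadj: "\<And>u s. u \<in> D \<Longrightarrow> s \<in> S \<Longrightarrow> {u, s} \<notin> E"
    and disj: "D \<inter> S = {}"
  shows "\<exists>\<tau>\<in>cls (X \<union> S) \<sigma>\<^sub>2. agree (X \<union> D) \<sigma>\<^sub>1 \<tau>"
proof
  define \<tau> where "\<tau> x = (if x \<in> D then \<sigma>\<^sub>1 x else if x \<in> X \<union> S then \<sigma>\<^sub>2 x else if x \<in> V then 0 else undefined)" for x
  have DX: "\<tau> x = \<sigma>\<^sub>1 x" if "x \<in> X \<union> D" for x using that s(3) by (auto simp: \<tau>_def agree_def)
  have SX: "\<tau> x = \<sigma>\<^sub>2 x" if "x \<in> X \<union> S" for x using that s(3) disj by (auto simp: \<tau>_def agree_def)
  have "\<tau> \<in> set_pmf \<mu>"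
  proof (rule hardcoreI)
    fix v show "v \<in> V \<Longrightarrow> \<tau> v = 0 \<or> \<tau> v = 1" "v \<notin> V \<Longrightarrow> \<tau> v = undefined"
      using s by (auto simp: \<tau>_def dest: hardcoreD)
  next
    fix u v assume e: "{u, v} \<in> E" "\<tau> u = 1"
    then have uv: "u \<in> V" "v \<in> V" using graph by (auto simp: simple_graph_def)
    show "\<tau> v \<noteq> 1"
    proof
      assume "\<tau> v = 1"
      then have "u \<in> X \<union> D \<union> S" "v \<in> X \<union> D \<union> S" using e uv by (auto simp: \<tau>_def split: if_splits)
      moreover have "\<not> (u \<in> D \<and> v \<in> S)" "\<not> (u \<in> S \<and> v \<in> D)"
        using nadj[of u v] nadj[of v u] e(1) by (auto simp: insert_commute)
      ultimately consider "u \<in> X \<union> D" "v \<in> X \<union> D" | "u \<in> X \<union> S" "v \<in> X \<union> S" by auto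
      then show False
        using e \<open>\<tau> v = 1\<close> DX SX hardcoreD(3)[OF s(1) e(1)] hardcoreD(3)[OF s(2) e(1)]
        by cases auto
    qed
  qed
  then show "\<tau> \<in> cls (X \<union> S) \<sigma>\<^sub>2" using SX by (auto simp: agree_def)
  show "agree (X \<union> D) \<sigma>\<^sub>1 \<tau>" using DX by (auto simp: agree_def)
qed

section \<open>From spatial mixing to the splitting of entropy\<close>

lemma measure_hardcore_eq_mass:
  assumes "\<And>\<tau>. \<tau> \<in> set_pmf \<mu> \<Longrightarrow> P \<tau> \<longleftrightarrow> agree Y \<sigma> \<tau>"
  shows "measure_pmf.prob \<mu> {\<tau>. P \<tau>} = mass Y \<sigma>"
proof -
  have "measure_pmf.prob \<mu> {\<tau>. P \<tau>} = measure_pmf.prob \<mu> ({\<tau>. P \<tau>} \<inter> set_pmf \<mu>)"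
    by (rule measure_Int_set_pmf[symmetric])
  also have "{\<tau>. P \<tau>} \<inter> set_pmf \<mu> = cls Y \<sigma>" using assms by auto
  also have "measure_pmf.prob \<mu> (cls Y \<sigma>) = mass Y \<sigma>"
    unfolding mass_def by (rule measure_measure_pmf_finite) auto
  finally show ?thesis .
qed

lemma restrict_eq_iff_agree: "restrict \<tau> Y = restrict \<sigma> Y \<longleftrightarrow> agree Y \<sigma> \<tau>"
  by (auto simp: agree_def fun_eq_iff restrict_def)

text \<open>The two quotients are the conditional probabilities of one and the same spin at
  \<open>u\<close> under two boundary conditions on \<open>W\<close>. Both configurations lie in the
  support and agree at \<open>u\<close>, whence all feasibility and positivity conditions of spatial
  mixing.\<close>

lemma ssm_mass_ratio:
  assumes ssm: "strong_spatial_mixing V E l C \<delta>"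
    and s: "\<sigma>\<^sub>1 \<in> set_pmf \<mu>" "\<sigma>\<^sub>2 \<in> set_pmf \<mu>" "agree (insert u \<Lambda>) \<sigma>\<^sub>1 \<sigma>\<^sub>2"
    and sub: "\<Lambda> \<subseteq> V" "u \<in> V - \<Lambda>" "W \<subseteq> V - (\<Lambda> \<union> {u})"
  shows "mass (insert u (\<Lambda> \<union> W)) \<sigma>\<^sub>1 / mass (\<Lambda> \<union> W) \<sigma>\<^sub>1
    \<le> (1 + C * power_enat (1 - \<delta>) (graph_setdist E u W))
      * (mass (insert u (\<Lambda> \<union> W)) \<sigma>\<^sub>2 / mass (\<Lambda> \<union> W) \<sigma>\<^sub>2)"
proof -
  define \<eta> where "\<eta> = restrict \<sigma>\<^sub>1 \<Lambda>"
  have eta2: "\<eta> = restrict \<sigma>\<^sub>2 \<Lambda>"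
    unfolding \<eta>_def using s(3) by (auto simp: agree_def fun_eq_iff restrict_def)
  have range: "restrict \<sigma> Y \<in> Y \<rightarrow>\<^sub>E {0, 1}" if "\<sigma> \<in> set_pmf \<mu>" "Y \<subseteq> V" for \<sigma> Y
    using hardcoreD(1)[OF that(1)] that(2) by (fastforce simp: PiE_iff)
  have marg: "cond_marginal V E l \<Lambda> \<eta> W (restrict \<sigma> W) u (\<sigma>\<^sub>1 u)
      = mass (insert u (\<Lambda> \<union> W)) \<sigma> / mass (\<Lambda> \<union> W) \<sigma>"
    if "\<sigma> \<in> {\<sigma>\<^sub>1, \<sigma>\<^sub>2}" for \<sigma>
  proof -
    have e: "\<eta> = restrict \<sigma> \<Lambda>" "\<sigma>\<^sub>1 u = \<sigma> u" using that \<eta>_def eta2 s(3) by (auto simp: agree_def)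
    have "measure_pmf.prob \<mu> {\<tau>. \<tau> u = \<sigma> u \<and> restrict \<tau> \<Lambda> = restrict \<sigma> \<Lambda> \<and> restrict \<tau> W = restrict \<sigma> W}
        = mass (insert u (\<Lambda> \<union> W)) \<sigma>"
      by (rule measure_hardcore_eq_mass) (auto simp: restrict_eq_iff_agree agree_def)
    moreover have "measure_pmf.prob \<mu> {\<tau>. restrict \<tau> \<Lambda> = restrict \<sigma> \<Lambda> \<and> restrict \<tau> W = restrict \<sigma> W}
        = mass (\<Lambda> \<union> W) \<sigma>"
      by (rule measure_hardcore_eq_mass) (auto simp: restrict_eq_iff_agree agree_def)
    ultimately show ?thesis unfolding cond_marginal_def cond_prob_def e by simp
  qed
  have prob\<Lambda>: "measure_pmf.prob \<mu> {\<tau>. restrict \<tau> \<Lambda> = \<eta>} > 0"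
    unfolding \<eta>_def using mass_pos[OF s(1), of \<Lambda>]
    by (subst measure_hardcore_eq_mass[of _ \<Lambda> \<sigma>\<^sub>1]) (auto simp: restrict_eq_iff_agree)
  have pin: "pinning V E l \<Lambda> \<eta>"
    unfolding pinning_def using range[OF s(1) sub(1)] prob\<Lambda> by (simp add: \<eta>_def)
  have spin: "feasible_spin V E l \<Lambda> \<eta> u (\<sigma>\<^sub>1 u)"
  proof -
    have "measure_pmf.prob \<mu> {\<tau>. \<tau> u = \<sigma>\<^sub>1 u \<and> restrict \<tau> \<Lambda> = \<eta>} > 0"
      unfolding \<eta>_def using mass_pos[OF s(1), of "insert u \<Lambda>"]
      by (subst measure_hardcore_eq_mass[of _ "insert u \<Lambda>" \<sigma>\<^sub>1]) (auto simp: restrict_eq_iff_agree agree_def)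
    then show ?thesis unfolding feasible_spin_def cond_prob_def
      using prob\<Lambda> hardcoreD(1)[OF s(1), of u] sub by simp
  qed
  have conf: "feasible_config V E l \<Lambda> \<eta> W (restrict \<sigma> W)" if "\<sigma> \<in> {\<sigma>\<^sub>1, \<sigma>\<^sub>2}" for \<sigma>
  proof -
    have sO: "\<sigma> \<in> set_pmf \<mu>" using that s by auto
    have e: "\<eta> = restrict \<sigma> \<Lambda>" using that \<eta>_def eta2 by auto
    have "measure_pmf.prob \<mu> {\<tau>. restrict \<tau> W = restrict \<sigma> W \<and> restrict \<tau> \<Lambda> = \<eta>} > 0"
      unfolding e using mass_pos[OF sO, of "\<Lambda> \<union> W"]
      by (subst measure_hardcore_eq_mass[of _ "\<Lambda> \<union> W" \<sigma>]) (auto simp: restrict_eq_iff_agree agree_Un)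
    then show ?thesis unfolding feasible_config_def cond_prob_def
      using prob\<Lambda> range[OF sO, of W] sub by simp blast
  qed
  let ?r = "\<lambda>\<sigma>. mass (insert u (\<Lambda> \<union> W)) \<sigma> / mass (\<Lambda> \<union> W) \<sigma>"
  have pos: "?r \<sigma>\<^sub>2 > 0" using mass_pos[OF s(2)] by simp
  have "\<bar>?r \<sigma>\<^sub>1 / ?r \<sigma>\<^sub>2 - 1\<bar> \<le> C * power_enat (1 - \<delta>) (graph_setdist E u W)"
    using ssm[unfolded strong_spatial_mixing_def, rule_format, OF sub(1) pin sub(2) spin sub(3)
        conf[of \<sigma>\<^sub>1] conf[of \<sigma>\<^sub>2]] marg[of \<sigma>\<^sub>1] marg[of \<sigma>\<^sub>2] pos by auto
  then have "?r \<sigma>\<^sub>1 / ?r \<sigma>\<^sub>2 \<le> 1 + C * power_enat (1 - \<delta>) (graph_setdist E u W)" by linarith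
  then show ?thesis using pos by (simp only: pos_divide_le_eq)
qed

text \<open>The chain rule for probabilities, revealing \<open>D\<close> vertex by vertex. A
  revealed vertex joins the pinning, because \<open>\<sigma>\<^sub>1\<close> and
  \<open>\<sigma>\<^sub>2\<close> agree there; the boundary on which they may differ remains
  \<open>S\<close>, so the distances to it do not shrink.\<close>

lemma mass_ratio_chain:
  assumes ssm: "strong_spatial_mixing V E l C \<delta>"
    and s: "\<sigma>\<^sub>1 \<in> set_pmf \<mu>" "\<sigma>\<^sub>2 \<in> set_pmf \<mu>" "agree (X \<union> D) \<sigma>\<^sub>1 \<sigma>\<^sub>2"
    and sub: "X \<subseteq> V" "S \<subseteq> V" "D \<subseteq> V" "X \<inter> S = {}" "D \<inter> X = {}" "D \<inter> S = {}"
    and \<kappa>: "\<kappa> \<ge> 0" "\<And>u. u \<in> D \<Longrightarrow> C * power_enat (1 - \<delta>) (graph_setdist E u S) \<le> \<kappa>"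
  shows "mass (X \<union> S \<union> D) \<sigma>\<^sub>1 / mass (X \<union> S) \<sigma>\<^sub>1
    \<le> (1 + \<kappa>) ^ card D * (mass (X \<union> S \<union> D) \<sigma>\<^sub>2 / mass (X \<union> S) \<sigma>\<^sub>2)"
proof -
  have "finite D" using sub finite_V by (metis finite_subset)
  then show ?thesis using s(3) sub(3,5,6) \<kappa>(2)
  proof (induction D)
    case empty
    then show ?case using mass_pos[OF s(1), of "X \<union> S"] mass_pos[OF s(2), of "X \<union> S"] by simp
  next
    case (insert u D)
    let ?A = "\<lambda>\<sigma>. mass (X \<union> S \<union> D) \<sigma> / mass (X \<union> S) \<sigma>"
    let ?B = "\<lambda>\<sigma>. mass (X \<union> S \<union> insert u D) \<sigma> / mass (X \<union> S \<union> D) \<sigma>"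
    have e: "X \<union> D \<union> S = X \<union> S \<union> D" "Set.insert u (X \<union> S \<union> D) = X \<union> S \<union> Set.insert u D" by auto
    have p0: "?A \<sigma>\<^sub>2 > 0" "?B \<sigma>\<^sub>2 > 0" "?A \<sigma>\<^sub>1 > 0" using mass_pos[OF s(2)] mass_pos[OF s(1)] by auto
    have "agree (X \<union> D) \<sigma>\<^sub>1 \<sigma>\<^sub>2" using insert.prems(1) by (rule agree_mono) auto
    then have A: "?A \<sigma>\<^sub>1 \<le> (1 + \<kappa>) ^ card D * ?A \<sigma>\<^sub>2" using insert by auto
    have "?B \<sigma>\<^sub>1 \<le> (1 + C * power_enat (1 - \<delta>) (graph_setdist E u S)) * ?B \<sigma>\<^sub>2"
    proof -
      have "S \<subseteq> V - (X \<union> D \<union> {u})" using sub insert.prems by auto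
      then show ?thesis
        using ssm_mass_ratio[OF ssm s(1,2), of u "X \<union> D" S] insert.prems insert.hyps sub
        unfolding e by auto
    qed
    also have "\<dots> \<le> (1 + \<kappa>) * ?B \<sigma>\<^sub>2" using insert.prems(5)[of u] p0 by (intro mult_right_mono) auto
    finally have B: "?B \<sigma>\<^sub>1 \<le> (1 + \<kappa>) * ?B \<sigma>\<^sub>2" .
    have "?A \<sigma>\<^sub>1 * ?B \<sigma>\<^sub>1 \<le> ((1 + \<kappa>) ^ card D * ?A \<sigma>\<^sub>2) * ((1 + \<kappa>) * ?B \<sigma>\<^sub>2)"
      using mass_pos[OF s(1)] p0 \<kappa>(1)
      by (intro mult_mono A B mult_nonneg_nonneg[OF _ less_imp_le[OF p0(1)]]) (auto simp: less_imp_le)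
    also have "\<dots> = (1 + \<kappa>) ^ card (Set.insert u D) * (?A \<sigma>\<^sub>2 * ?B \<sigma>\<^sub>2)"
      by (simp only: card_insert_disjoint[OF insert.hyps] power_Suc mult_ac)
    finally have "?A \<sigma>\<^sub>1 * ?B \<sigma>\<^sub>1 \<le> (1 + \<kappa>) ^ card (Set.insert u D) * (?A \<sigma>\<^sub>2 * ?B \<sigma>\<^sub>2)" .
    moreover have "?A \<sigma> * ?B \<sigma> = mass (X \<union> S \<union> insert u D) \<sigma> / mass (X \<union> S) \<sigma>"
      if "\<sigma> \<in> set_pmf \<mu>" for \<sigma> using mass_pos[OF that, of "X \<union> S \<union> D"] by auto
    ultimately show ?case by (simp only: s(1,2))
  qed
qed

text \<open>\<open>S\<close> is the piece cut out and \<open>D\<close> the part far from it; the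
  collar lies in neither. \<open>ent (X \<union> D) f\<close> leaves the piece and its collar free,
  \<open>ent (X \<union> S) f\<close> everything but the piece. The 8 is 4 from the two-block
  inequality times 2 from linearising \<open>(1 + \<kappa>) ^ N\<close>.\<close>

lemma ent_carve:
  assumes ssm: "strong_spatial_mixing V E l C \<delta>"
    and sub: "X \<subseteq> V" "S \<subseteq> V" "D \<subseteq> V" "X \<inter> S = {}" "D \<inter> X = {}" "D \<inter> S = {}"
    and \<kappa>: "\<kappa> \<ge> 0" "\<And>u. u \<in> D \<Longrightarrow> C * power_enat (1 - \<delta>) (graph_setdist E u S) \<le> \<kappa>"
    and nadj: "\<And>u s. u \<in> D \<Longrightarrow> s \<in> S \<Longrightarrow> {u, s} \<notin> E"
    and small: "card D \<le> N" "real N * \<kappa> \<le> 1"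
    and f: "\<And>\<tau>. \<tau> \<in> set_pmf \<mu> \<Longrightarrow> f \<tau> \<ge> 0"
  shows "(1 - 8 * (real N * \<kappa>)) * ent X f \<le> ent (X \<union> D) f + ent (X \<union> S) f"
proof -
  define \<epsilon> where "\<epsilon> = 2 * (real N * \<kappa>)"
  have eps: "\<epsilon> \<ge> 0" using \<kappa> by (simp add: \<epsilon>_def)
  have "(1 + \<kappa>) ^ card D \<le> (1 + \<kappa>) ^ N" using \<kappa> small by (intro power_increasing) auto
  also have "\<dots> \<le> 1 + \<epsilon>" unfolding \<epsilon>_def using \<kappa> small by (intro one_plus_power_le) auto
  finally have pe: "(1 + \<kappa>) ^ card D \<le> 1 + \<epsilon>" .
  have "(1 - 4 * \<epsilon>) * ent X f \<le> ent (X \<union> D) f + ent (X \<union> S) f"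
  proof (rule ent_two_blocks[OF f eps])
    fix g \<sigma> assume s: "\<sigma> \<in> set_pmf \<mu>"
      and g: "\<And>\<rho> \<tau>. \<rho> \<in> set_pmf \<mu> \<Longrightarrow> \<tau> \<in> set_pmf \<mu> \<Longrightarrow> agree (X \<union> D) \<rho> \<tau> \<Longrightarrow> (g \<rho> :: real) = g \<tau>"
    show "\<bar>cexp (X \<union> S) g \<sigma> - cexp X g \<sigma>\<bar> \<le> \<epsilon> * cexp X (\<lambda>\<tau>. \<bar>g \<tau>\<bar>) \<sigma>"
    proof (rule cexp_near[OF s eps _ g])
      fix g :: "('a \<Rightarrow> nat) \<Rightarrow> real" and \<sigma>\<^sub>1 \<sigma>\<^sub>2
      assume s12: "\<sigma>\<^sub>1 \<in> set_pmf \<mu>" "\<sigma>\<^sub>2 \<in> set_pmf \<mu>" and ag: "agree X \<sigma>\<^sub>1 \<sigma>\<^sub>2"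
        and g: "\<And>\<rho>. \<rho> \<in> set_pmf \<mu> \<Longrightarrow> g \<rho> \<ge> 0"
          "\<And>\<rho> \<tau>. \<rho> \<in> set_pmf \<mu> \<Longrightarrow> \<tau> \<in> set_pmf \<mu> \<Longrightarrow> agree (X \<union> D) \<rho> \<tau> \<Longrightarrow> g \<rho> = g \<tau>"
      show "cexp (X \<union> S) g \<sigma>\<^sub>1 \<le> (1 + \<epsilon>) * cexp (X \<union> S) g \<sigma>\<^sub>2"
      proof (rule cexp_ratio[OF s12 _ _ _ g])
        fix \<rho> \<tau> assume r: "\<rho> \<in> cls (X \<union> S) \<sigma>\<^sub>1" and t: "\<tau> \<in> cls (X \<union> S) \<sigma>\<^sub>2" and rt: "agree (X \<union> D) \<rho> \<tau>"
        have e: "X \<union> S \<union> (X \<union> D) = X \<union> S \<union> D" by auto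
        have "mass (X \<union> S \<union> D) \<rho> / mass (X \<union> S) \<rho>
            \<le> (1 + \<kappa>) ^ card D * (mass (X \<union> S \<union> D) \<tau> / mass (X \<union> S) \<tau>)"
          using r t rt sub \<kappa> by (intro mass_ratio_chain[OF ssm]) auto
        also have "\<dots> \<le> (1 + \<epsilon>) * (mass (X \<union> S \<union> D) \<tau> / mass (X \<union> S) \<tau>)"
          using pe t mass_pos[of \<tau>] by (intro mult_right_mono) (auto simp: less_imp_le)
        finally show "mass (X \<union> S \<union> (X \<union> D)) \<rho> / mass (X \<union> S) \<rho>
            \<le> (1 + \<epsilon>) * (mass (X \<union> S \<union> (X \<union> D)) \<tau> / mass (X \<union> S) \<tau>)" unfolding e .
      next
        fix \<rho> assume "\<rho> \<in> cls (X \<union> S) \<sigma>\<^sub>1"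
        then have "\<rho> \<in> set_pmf \<mu>" "agree X \<rho> \<sigma>\<^sub>2" using ag by (auto simp: agree_def)
        then show "\<exists>\<tau>\<in>cls (X \<union> S) \<sigma>\<^sub>2. agree (X \<union> D) \<rho> \<tau>"
          using s12 nadj sub by (intro ex_hardcore_glue) auto
      next
        fix \<tau> assume "\<tau> \<in> cls (X \<union> S) \<sigma>\<^sub>2"
        then have "\<tau> \<in> set_pmf \<mu>" "agree X \<tau> \<sigma>\<^sub>1" using ag by (auto simp: agree_def)
        then show "\<exists>\<rho>\<in>cls (X \<union> S) \<sigma>\<^sub>1. agree (X \<union> D) \<tau> \<rho>"
          using s12 nadj sub by (intro ex_hardcore_glue) auto
      qed
    qed
  qed
  then show ?thesis by (simp add: \<epsilon>_def)
qed

section \<open>Tensorization of entropy\<close>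

text \<open>Only the number of free vertices is bounded, not the graph around them, which makes a
  recursion on \<open>N\<close> inside a fixed graph possible.\<close>

definition ent_tensor :: "real \<Rightarrow> nat \<Rightarrow> bool" where
  "ent_tensor k N \<longleftrightarrow> (\<forall>f U. (\<forall>\<tau>\<in>set_pmf \<mu>. f \<tau> \<ge> 0) \<longrightarrow> U \<subseteq> V \<longrightarrow> card U \<le> N \<longrightarrow>
    ent (V - U) f \<le> k * (\<Sum>x\<in>U. ent (V - {x}) f))"

lemma ent_tensor_mono:
  assumes "ent_tensor k N" "k \<le> k'"
  shows "ent_tensor k' N"
  unfolding ent_tensor_def
proof (intro allI impI)
  fix f :: "('a \<Rightarrow> nat) \<Rightarrow> real" and U
  assume f: "\<forall>\<tau>\<in>set_pmf \<mu>. f \<tau> \<ge> 0" and U: "U \<subseteq> V" "card U \<le> N"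
  have "ent (V - U) f \<le> k * (\<Sum>x\<in>U. ent (V - {x}) f)" using assms(1) f U by (auto simp: ent_tensor_def)
  also have "\<dots> \<le> k' * (\<Sum>x\<in>U. ent (V - {x}) f)"
    using assms(2) f by (intro mult_right_mono sum_nonneg ent_nonneg) auto
  finally show "ent (V - U) f \<le> k' * (\<Sum>x\<in>U. ent (V - {x}) f)" .
qed

lemma agree_V_eq:
  assumes "\<sigma> \<in> set_pmf \<mu>" "\<tau> \<in> set_pmf \<mu>" "agree V \<sigma> \<tau>"
  shows "\<sigma> = \<tau>"
proof
  fix x show "\<sigma> x = \<tau> x"
    using assms hardcoreD(2)[of \<sigma> x] hardcoreD(2)[of \<tau> x] by (cases "x \<in> V") (auto simp: agree_def)
qed

lemma ent_V: "ent V f = 0"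
  unfolding ent_def
proof (intro sum.neutral ballI)
  fix \<sigma> assume s: "\<sigma> \<in> set_pmf \<mu>"
  have "cexp V f \<sigma> = cexp V (\<lambda>_. f \<sigma>) \<sigma>" using agree_V_eq s by (intro cexp_cong) auto
  then show "pmf \<mu> \<sigma> * (f \<sigma> * ln (f \<sigma> / cexp V f \<sigma>)) = 0" using s by (simp add: cexp_const)
qed

section \<open>Crude tensorization for small blocks\<close>

text \<open>Given the spins outside \<open>U\<close>, the weights of the completions share a common
  factor and otherwise lie between \<open>min 1 l ^ N\<close> and \<open>max 1 l ^ N\<close>; there
  are at most \<open>2 ^ N\<close> completions.\<close>

lemma cond_prob_lower_bound:
  assumes s: "\<sigma> \<in> set_pmf \<mu>" and U: "U \<subseteq> V" "card U \<le> N" and t: "\<tau> \<in> cls (V - U) \<sigma>"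
  shows "(min 1 l / (2 * max 1 l)) ^ N \<le> pmf \<mu> \<tau> / mass (V - U) \<sigma>"
proof -
  define Z where "Z = (\<Sum>\<tau>\<in>V \<rightarrow>\<^sub>E {0, 1}. hardcore_weight V E l \<tau>)"
  define k where "k = card {v\<in>V - U. \<sigma> v = 1}"
  have fU: "finite U" using U finite_V by (metis finite_subset)
  have Z: "Z > 0" unfolding Z_def using graph l_pos by (rule hardcore_partition_pos)
  have pm: "pmf \<mu> \<rho> = l ^ k * l ^ card {v\<in>U. \<rho> v = 1} / Z" if "\<rho> \<in> cls (V - U) \<sigma>" for \<rho>
  proof -
    have "{v\<in>V. \<rho> v = 1} = {v\<in>V - U. \<sigma> v = 1} \<union> {v\<in>U. \<rho> v = 1}"
      using that U by (auto simp: agree_def)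
    also have "card \<dots> = k + card {v\<in>U. \<rho> v = 1}"
      unfolding k_def using fU by (intro card_Un_disjoint) auto
    finally have c: "card {v\<in>V. \<rho> v = 1} = k + card {v\<in>U. \<rho> v = 1}" .
    have "\<rho> \<in> set_pmf \<mu>" using that by simp
    then have "hardcore_weight V E l \<rho> = l ^ card {v\<in>V. \<rho> v = 1}"
      unfolding set_hardcore hardcore_weight_def by simp
    then show ?thesis unfolding pmf_hardcore[OF graph l_pos] Z_def c by (simp only: power_add)
  qed
  have cU: "card {v\<in>U. \<rho> v = 1} \<le> N" for \<rho> :: "'a \<Rightarrow> nat"
    using card_mono[OF fU, of "{v\<in>U. \<rho> v = 1}"] U by auto
  have up: "l ^ i \<le> max 1 l ^ N" if "i \<le> N" for i
  proof -
    have "l ^ i \<le> max 1 l ^ i" using l_pos by (intro power_mono) auto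
    also have "\<dots> \<le> max 1 l ^ N" using that by (intro power_increasing) auto
    finally show ?thesis .
  qed
  have lo: "min 1 l ^ N \<le> l ^ i" if "i \<le> N" for i
  proof -
    have "min 1 l ^ N \<le> min 1 l ^ i" using that l_pos by (intro power_decreasing) auto
    also have "\<dots> \<le> l ^ i" using l_pos by (intro power_mono) auto
    finally show ?thesis .
  qed
  have "inj_on (\<lambda>\<rho>. {v\<in>U. \<rho> v = 1}) (cls (V - U) \<sigma>)"
  proof (rule inj_onI)
    fix \<rho> \<tau> assume r: "\<rho> \<in> cls (V - U) \<sigma>" and t: "\<tau> \<in> cls (V - U) \<sigma>"
      and e: "{v\<in>U. \<rho> v = 1} = {v\<in>U. \<tau> v = 1}"
    have "\<rho> x = \<tau> x" if "x \<in> V" for x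
    proof (cases "x \<in> U")
      case True
      then have "\<rho> x = 1 \<longleftrightarrow> \<tau> x = 1" using e by auto
      then show ?thesis using that r t hardcoreD(1)[of \<rho> x] hardcoreD(1)[of \<tau> x] by auto
    next
      case False
      then have "\<sigma> x = \<rho> x" "\<sigma> x = \<tau> x" using that r t by (auto simp: agree_def)
      then show ?thesis by simp
    qed
    then show "\<rho> = \<tau>" using r t by (intro agree_V_eq) (auto simp: agree_def)
  qed
  then have "card (cls (V - U) \<sigma>) \<le> card (Pow U)" using fU by (intro card_inj_on_le) auto
  also have "\<dots> \<le> 2 ^ N" using U fU by (simp add: card_Pow)
  finally have "card (cls (V - U) \<sigma>) \<le> 2 ^ N" .
  then have c2: "real (card (cls (V - U) \<sigma>)) \<le> 2 ^ N"
    by (metis of_nat_le_iff of_nat_numeral of_nat_power)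
  have "mass (V - U) \<sigma> \<le> (\<Sum>\<rho>\<in>cls (V - U) \<sigma>. l ^ k * max 1 l ^ N / Z)"
    unfolding mass_def using pm Z l_pos up cU
    by (intro sum_mono) (auto intro!: divide_right_mono mult_left_mono)
  also have "\<dots> = real (card (cls (V - U) \<sigma>)) * (l ^ k * max 1 l ^ N / Z)" by simp
  also have "\<dots> \<le> 2 ^ N * (l ^ k * max 1 l ^ N / Z)"
    using c2 Z l_pos by (intro mult_right_mono) auto
  finally have m: "mass (V - U) \<sigma> \<le> l ^ k * (2 * max 1 l) ^ N / Z" by (simp add: power_mult_distrib mult_ac)
  have r0: "(min 1 l / (2 * max 1 l)) ^ N \<ge> 0" using l_pos by simp
  have "(min 1 l / (2 * max 1 l)) ^ N * mass (V - U) \<sigma>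
      \<le> (min 1 l / (2 * max 1 l)) ^ N * (l ^ k * (2 * max 1 l) ^ N / Z)"
    using m r0 by (intro mult_left_mono) auto
  also have "\<dots> = l ^ k * min 1 l ^ N / Z"
  proof -
    have "(2 * max 1 l) ^ N \<noteq> 0" by (simp add: max_def)
    then show ?thesis by (simp add: power_divide)
  qed
  also have "\<dots> \<le> pmf \<mu> \<tau>"
    unfolding pm[OF t] using lo[OF cU] l_pos Z by (intro divide_right_mono mult_left_mono) auto
  finally show ?thesis using mass_pos[OF s] by (simp add: pos_le_divide_eq)
qed

text \<open>Telescoping along the path that empties \<open>T\<close> one vertex at a time. Every
  move is charged the whole sum \<open>B\<close> rather than the term of its own vertex, which is
  wasteful but harmless.\<close>

lemma sqrt_clear_le:
  assumes f: "\<And>\<tau>. \<tau> \<in> set_pmf \<mu> \<Longrightarrow> f \<tau> \<ge> 0" and s: "\<sigma> \<in> set_pmf \<mu>" and U: "U \<subseteq> V"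
    and r: "r > 0" "\<And>\<tau>. \<tau> \<in> cls (V - U) \<sigma> \<Longrightarrow> r \<le> pmf \<mu> \<tau> / mass (V - U) \<sigma>"
    and t: "\<tau> \<in> cls (V - U) \<sigma>" and T: "T \<subseteq> U"
  defines "B \<equiv> \<Sum>x\<in>U. cexp (V - U) (\<lambda>\<tau>. f \<tau> * ln (f \<tau> / cexp (V - {x}) f \<tau>)) \<sigma>"
  shows "\<bar>sqrt (f \<tau>) - sqrt (f (clear T \<tau>))\<bar> \<le> card T * sqrt (2 * B / r)"
proof -
  have fU: "finite U" using U finite_V by (metis finite_subset)
  then have "finite T" using T by (metis finite_subset)
  then show ?thesis using T
  proof induction
    case empty
    then show ?case by (simp add: clear_def)
  next
    case (insert x T)
    let ?e = "\<lambda>x. cexp (V - U) (\<lambda>\<tau>. f \<tau> * ln (f \<tau> / cexp (V - {x}) f \<tau>)) \<sigma>"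
    have e0: "?e y \<ge> 0" if "y \<in> U" for y
    proof -
      have "0 \<le> cexp (V - U) (\<lambda>\<tau>. (sqrt (f \<tau>) - sqrt (cexp (V - {y}) f \<tau>))\<^sup>2) \<sigma>"
        using s by (intro cexp_nonneg) auto
      also have "\<dots> \<le> ?e y" using that by (intro hellinger_ent s f) auto
      finally show ?thesis .
    qed
    have c: "clear Y \<tau> \<in> cls (V - U) \<sigma>" if "Y \<subseteq> U" for Y
      using t that U clear_hardcore[of \<tau> Y] by (auto simp: agree_def clear_def)
    have "r * (sqrt (f (clear T \<tau>)) - sqrt (f (clear (Set.insert x T) \<tau>)))\<^sup>2 \<le> 2 * ?e x"
    proof (rule sqrt_le_ent[OF f s _ c c])
      show "agree (V - {x}) (clear T \<tau>) (clear (Set.insert x T) \<tau>)" by (auto simp: agree_def clear_def)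
    qed (use insert.prems r c in auto)
    also have "\<dots> \<le> 2 * B" unfolding B_def using insert.prems fU e0
      by (intro mult_left_mono member_le_sum) auto
    finally have "(sqrt (f (clear T \<tau>)) - sqrt (f (clear (Set.insert x T) \<tau>)))\<^sup>2 \<le> 2 * B / r"
      using r by (simp add: field_simps)
    then have "\<bar>sqrt (f (clear T \<tau>)) - sqrt (f (clear (Set.insert x T) \<tau>))\<bar> \<le> sqrt (2 * B / r)"
      by (metis real_sqrt_abs real_sqrt_le_mono)
    moreover have "\<bar>sqrt (f \<tau>) - sqrt (f (clear T \<tau>))\<bar> \<le> card T * sqrt (2 * B / r)"
      using insert by auto
    ultimately show ?case using insert.hyps by (simp add: algebra_simps)
  qed
qed

text \<open>The base of the recursion, applied only below a fixed threshold, so that the exponential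
  constant does no damage. All configurations of a class are joined through the one that is empty on
  \<open>U\<close>, which bounds the oscillation of \<open>sqrt f\<close>.\<close>

lemma ent_tensor_crude:
  "ent_tensor (32 * real N ^ 2 / (min 1 l / (2 * max 1 l)) ^ N) N"
  unfolding ent_tensor_def
proof (intro allI impI)
  fix f :: "('a \<Rightarrow> nat) \<Rightarrow> real" and U
  assume f': "\<forall>\<tau>\<in>set_pmf \<mu>. f \<tau> \<ge> 0" and U: "U \<subseteq> V" "card U \<le> N"
  then have f: "\<And>\<tau>. \<tau> \<in> set_pmf \<mu> \<Longrightarrow> f \<tau> \<ge> 0" by auto
  define r where "r = (min 1 l / (2 * max 1 l)) ^ N"
  have r: "r > 0" unfolding r_def using l_pos by simp
  let ?X = "V - U"
  let ?e = "\<lambda>x. cexp ?X (\<lambda>\<tau>. f \<tau> * ln (f \<tau> / cexp (V - {x}) f \<tau>))"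
  have loc: "cexp ?X (\<lambda>\<tau>. f \<tau> * ln (f \<tau> / cexp ?X f \<tau>)) \<sigma> \<le> 32 * real N ^ 2 / r * (\<Sum>x\<in>U. ?e x \<sigma>)"
    if s: "\<sigma> \<in> set_pmf \<mu>" for \<sigma>
  proof -
    define B where "B = (\<Sum>x\<in>U. ?e x \<sigma>)"
    have B0: "B \<ge> 0" unfolding B_def
    proof (intro sum_nonneg)
      fix y assume y: "y \<in> U"
      have "0 \<le> cexp (V - U) (\<lambda>\<tau>. (sqrt (f \<tau>) - sqrt (cexp (V - {y}) f \<tau>))\<^sup>2) \<sigma>"
        using s by (intro cexp_nonneg) auto
      also have "\<dots> \<le> ?e y \<sigma>" using y by (intro hellinger_ent s f) auto
      finally show "0 \<le> ?e y \<sigma>" .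
    qed
    have bd: "\<bar>sqrt (f \<tau>) - sqrt (f (clear U \<tau>))\<bar> \<le> N * sqrt (2 * B / r)" if t: "\<tau> \<in> cls ?X \<sigma>" for \<tau>
    proof -
      have "\<bar>sqrt (f \<tau>) - sqrt (f (clear U \<tau>))\<bar> \<le> card U * sqrt (2 * B / r)"
        unfolding B_def
        by (rule sqrt_clear_le[OF f s U(1) r _ t order_refl])
          (auto simp: r_def intro!: cond_prob_lower_bound s U)
      also have "\<dots> \<le> N * sqrt (2 * B / r)" using U B0 r by (intro mult_right_mono) auto
      finally show ?thesis .
    qed
    \<comment> \<open>Twice the distance to the emptied configuration; 4 * 2^2 * 2 is the constant
      32.\<close>
    have "cexp ?X (\<lambda>\<tau>. f \<tau> * ln (f \<tau> / cexp ?X f \<tau>)) \<sigma> \<le> 4 * (2 * (N * sqrt (2 * B / r)))\<^sup>2"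
    proof (rule ent_le_sqrt_osc[OF f s])
      fix \<tau> \<tau>' assume t: "\<tau> \<in> cls ?X \<sigma>" "\<tau>' \<in> cls ?X \<sigma>"
      have "clear U \<tau> = clear U \<tau>'"
        using t U clear_hardcore[of \<tau> U] clear_hardcore[of \<tau>' U]
        by (intro agree_V_eq) (auto simp: agree_def clear_def)
      then show "\<bar>sqrt (f \<tau>) - sqrt (f \<tau>')\<bar> \<le> 2 * (N * sqrt (2 * B / r))"
        using bd[OF t(1)] bd[OF t(2)] by (simp add: abs_le_iff)
    qed
    also have "\<dots> = 32 * real N ^ 2 / r * B" using B0 r by (simp add: power_mult_distrib)
    finally show ?thesis unfolding B_def .
  qed
  have "ent ?X f \<le> (\<Sum>\<sigma>\<in>set_pmf \<mu>. pmf \<mu> \<sigma> * (32 * real N ^ 2 / r * (\<Sum>x\<in>U. ?e x \<sigma>)))"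
    unfolding ent_eq_cexp[of ?X f ?X] by (intro sum_mono mult_left_mono loc) auto
  also have "\<dots> = (\<Sum>\<sigma>\<in>set_pmf \<mu>. \<Sum>x\<in>U. 32 * real N ^ 2 / r * (pmf \<mu> \<sigma> * ?e x \<sigma>))"
    by (simp add: sum_distrib_left mult_ac)
  also have "\<dots> = (\<Sum>x\<in>U. \<Sum>\<sigma>\<in>set_pmf \<mu>. 32 * real N ^ 2 / r * (pmf \<mu> \<sigma> * ?e x \<sigma>))"
    by (rule sum.swap)
  also have "\<dots> = 32 * real N ^ 2 / r * (\<Sum>x\<in>U. ent (V - {x}) f)"
    unfolding ent_eq_cexp[of _ f ?X] by (simp only: sum_distrib_left)
  finally show "ent (V - U) f \<le> 32 * real N ^ 2 / (min 1 l / (2 * max 1 l)) ^ N * (\<Sum>x\<in>U. ent (V - {x}) f)"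
    unfolding r_def .
qed

text \<open>Region growing: a ball around any vertex stops doubling its weight before radius \<open>J * R\<close>.
  Cutting it out together with a collar of width \<open>R\<close> costs at most its own weight again.\<close>

lemma ent_tensor_step:
  assumes ssm: "strong_spatial_mixing V E l C \<delta>" and C: "C > 0" and \<delta>: "0 < \<delta>" "\<delta> < 1"
    and small: "ent_tensor k m" "k \<ge> 0"
    and N: "N \<ge> 1" "16 * real N ^ 2 * (C * (1 - \<delta>) ^ R) \<le> 1"
    and R: "R \<ge> 1" and J: "2 * real N \<le> 2 ^ J"
    and ball: "\<And>v. v \<in> V \<Longrightarrow> card {u\<in>V. graph_dist E u v \<le> enat (J * R)} \<le> m"
  shows "ent_tensor (8 * k) N"
  unfolding ent_tensor_def
proof (intro allI impI)
  fix f :: "('a \<Rightarrow> nat) \<Rightarrow> real" and U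
  assume f': "\<forall>\<tau>\<in>set_pmf \<mu>. f \<tau> \<ge> 0" and U: "U \<subseteq> V" "card U \<le> N"
  then have f: "\<And>\<tau>. \<tau> \<in> set_pmf \<mu> \<Longrightarrow> f \<tau> \<ge> 0" by auto
  have fU: "finite U" using U finite_V by (metis finite_subset)
  define w where "w x = ent (V - {x}) f" for x
  define W where "W = sum w U"
  \<comment> \<open>The added share makes every vertex weigh at least \<open>W / N\<close>, from
    which the doubling can start, and at most doubles the total.\<close>
  define w' where "w' x = w x + W / N" for x
  define \<kappa> where "\<kappa> = C * (1 - \<delta>) ^ R"
  define \<theta> where "\<theta> = 8 * (real N * \<kappa>)"
  have w0: "w x \<ge> 0" for x unfolding w_def by (rule ent_nonneg[OF f])
  have W0: "W \<ge> 0" unfolding W_def by (intro sum_nonneg w0)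
  have w'0: "w' x \<ge> 0" for x unfolding w'_def using w0 W0 by simp
  have \<kappa>0: "\<kappa> \<ge> 0" unfolding \<kappa>_def using C \<delta> by simp
  have \<theta>: "\<theta> \<ge> 0" "real N * \<theta> \<le> 1 / 2"
    using N \<kappa>0 by (auto simp: \<theta>_def \<kappa>_def power2_eq_square)
  have \<theta>1: "\<theta> \<le> 1 / 2"
  proof -
    have "\<theta> \<le> real N * \<theta>" using N \<theta>(1) by (simp add: mult_le_cancel_right1)
    then show ?thesis using \<theta>(2) by linarith
  qed
  have sumU: "sum w' U \<le> 2 * W"
  proof -
    have "sum w' U = W + card U * (W / N)" by (simp add: w'_def W_def sum.distrib)
    also have "card U * (W / N) \<le> N * (W / N)" using U W0 by (intro mult_right_mono) auto
    finally show ?thesis using N by simp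
  qed
  \<comment> \<open>Each carving removes at least its centre, so \<open>card U'\<close> bounds the
    number of carvings and hence the exponent of the loss \<open>1 - \<theta>\<close>.\<close>
  have main: "(1 - \<theta>) ^ card U' * ent (V - U') f \<le> 2 * k * sum w' U'" if "U' \<subseteq> U" for U'
  proof -
    have "finite U'" using that fU by (rule finite_subset)
    then show ?thesis using that
    proof (induction U' rule: finite_psubset_induct)
      case (psubset U')
      show ?case
      proof (cases "U' = {}")
        case True
        then show ?thesis by (simp add: ent_V)
      next
        case False
        then obtain v where v: "v \<in> U'" by auto
        define ball where "ball j = {u\<in>U'. graph_dist E u v \<le> enat (j * R)}" for j
        have bsub: "ball j \<subseteq> U'" for j by (auto simp: ball_def)
        have fb: "finite (ball j)" for j using bsub psubset.hyps(1) by (rule finite_subset)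
        have vb: "v \<in> ball j" for j using v by (simp add: ball_def zero_enat_def[symmetric])
        \<comment> \<open>Otherwise the ball of radius \<open>J * R\<close> would weigh more than
          \<open>2 ^ J * (W / N)\<close>, thus more than \<open>2 * W\<close>, which bounds the
          weight of all of \<open>U\<close>.\<close>
        have "\<exists>j<J. sum w' (ball (Suc j)) \<le> 2 * sum w' (ball j)"
        proof (rule ccontr)
          assume "\<not> ?thesis"
          then have g: "\<And>j. j < J \<Longrightarrow> 2 * sum w' (ball j) < sum w' (ball (Suc j))" by force
          have le: "2 ^ j * (W / N) \<le> sum w' (ball j)" if "j \<le> J" for j
            using that
          proof (induction j)
            case 0
            have "W / N \<le> w' v" using w0 by (simp add: w'_def)
            also have "\<dots> \<le> sum w' (ball 0)" using vb fb w'0 by (intro member_le_sum) auto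
            finally show ?case by simp
          next
            case (Suc j)
            then show ?case using g[of j] by auto
          qed
          \<comment> \<open>With \<open>J \<noteq> 0\<close> at least one strict doubling is used,
            so the final inequality is strict even if \<open>W = 0\<close>.\<close>
          have "J \<noteq> 0" using J N by (intro notI) auto
          then obtain i where i: "J = Suc i" by (cases J) auto
          have "2 ^ J * (W / N) = 2 * (2 ^ i * (W / N))" using i by simp
          also have "\<dots> \<le> 2 * sum w' (ball i)" using le[of i] i by simp
          also have "\<dots> < sum w' (ball J)" using g[of i] i by simp
          also have "\<dots> \<le> sum w' U" using bsub[of J] psubset.prems fU w'0 by (intro sum_mono2) auto
          also have "\<dots> \<le> 2 * W" by (rule sumU)
          finally have "2 ^ J * (W / N) < 2 * W" .
          moreover have "2 * real N * (W / N) \<le> 2 ^ J * (W / N)"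
            using J W0 by (intro mult_right_mono) auto
          ultimately show False using N by simp
        qed
        then obtain j where j: "j < J" "sum w' (ball (Suc j)) \<le> 2 * sum w' (ball j)" by auto
        \<comment> \<open>Only \<open>S\<close> leaves \<open>U'\<close>. The collar
          \<open>A - S\<close> is charged now and stays in \<open>U'\<close> to be charged again
          later; the choice of \<open>j\<close> pays for this.\<close>
        define S where "S = ball j"
        define A where "A = ball (Suc j)"
        have SA: "S \<subseteq> A" "A \<subseteq> U'" "v \<in> S"
        proof -
          have "enat (j * R) \<le> enat (Suc j * R)" by simp
          then show "S \<subseteq> A" unfolding S_def A_def ball_def by (auto intro: order_trans)
        qed (auto simp: A_def S_def bsub vb)
        have UV: "U' \<subseteq> V" using psubset.prems U by auto
        \<comment> \<open>Outside the ball of radius \<open>Suc j * R\<close> the distance to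
          \<open>S\<close> exceeds \<open>R\<close> strictly; as \<open>R \<ge> 1\<close>, this also
          excludes an edge.\<close>
        have far: "graph_dist E u s \<ge> enat R \<and> {u, s} \<notin> E" if u: "u \<in> U' - A" and s: "s \<in> S" for u s
        proof -
          have "enat (R + j * R) < graph_dist E u v" using u by (auto simp: A_def ball_def)
          also have "\<dots> \<le> graph_dist E u s + graph_dist E s v" by (rule graph_dist_triangle)
          also have "\<dots> \<le> graph_dist E u s + enat (j * R)"
            using s by (intro add_left_mono) (auto simp: S_def ball_def)
          finally have "enat R < graph_dist E u s" by (cases "graph_dist E u s") auto
          moreover have "graph_dist E u s \<le> enat R" if "{u, s} \<in> E"
          proof -
            have "graph_dist E u s \<le> 1" using that by (rule graph_dist_edge)
            also have "1 \<le> enat R" using R by (simp add: one_enat_def)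
            finally show ?thesis .
          qed
          ultimately show ?thesis by auto
        qed
        have carve: "(1 - \<theta>) * ent (V - U') f \<le> ent (V - A) f + ent (V - (U' - S)) f"
        proof -
          have e: "V - U' \<union> (U' - A) = V - A" "V - U' \<union> S = V - (U' - S)" using UV SA by auto
          have "(1 - 8 * (real N * \<kappa>)) * ent (V - U') f
              \<le> ent (V - U' \<union> (U' - A)) f + ent (V - U' \<union> S) f"
          proof (rule ent_carve[OF ssm _ _ _ _ _ _ \<kappa>0 _ _ _ _ f])
            fix u assume u: "u \<in> U' - A"
            have "enat R \<le> graph_setdist E u S"
              unfolding graph_setdist_def using far u by (intro INF_greatest) auto
            then show "C * power_enat (1 - \<delta>) (graph_setdist E u S) \<le> \<kappa>"
              unfolding \<kappa>_def using C \<delta> by (intro mult_left_mono power_enat_antimono) auto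
          next
            have "card (U' - A) \<le> card U" using psubset.prems fU by (intro card_mono) auto
            then show "card (U' - A) \<le> N" using U by simp
            have "0 \<le> real N * \<kappa>" using \<kappa>0 by simp
            then show "real N * \<kappa> \<le> 1" using \<theta>1 unfolding \<theta>_def by linarith
          qed (use UV SA far in auto)
          then show ?thesis unfolding e \<theta>_def .
        qed
        have "card A \<le> card {u\<in>V. graph_dist E u v \<le> enat (J * R)}"
        proof (intro card_mono)
          have "Suc j * R \<le> J * R" using j(1) by (intro mult_le_mono1) auto
          then have "enat (Suc j * R) \<le> enat (J * R)" by (simp only: enat_ord_simps)
          then show "A \<subseteq> {u\<in>V. graph_dist E u v \<le> enat (J * R)}"
            using UV unfolding A_def ball_def by (auto intro: order_trans)
        qed auto
        also have "\<dots> \<le> m" using v UV by (intro assms(11)) auto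
        finally have "ent (V - A) f \<le> k * sum w A"
          using small(1) f' SA UV unfolding ent_tensor_def w_def by blast
        also have "\<dots> \<le> k * sum w' A"
          using small(2) W0 by (intro mult_left_mono sum_mono) (auto simp: w'_def)
        also have "\<dots> \<le> k * (2 * sum w' S)" using small(2) j(2) by (intro mult_left_mono) (auto simp: A_def S_def)
        finally have EA: "ent (V - A) f \<le> 2 * k * sum w' S" by simp
        have IH: "(1 - \<theta>) ^ card (U' - S) * ent (V - (U' - S)) f \<le> 2 * k * sum w' (U' - S)"
          using SA v psubset.prems by (intro psubset.IH) auto
        have cle: "Suc (card (U' - S)) \<le> card U'"
          using SA v psubset.hyps(1) by (intro Suc_leI psubset_card_mono) auto
        have "(1 - \<theta>) ^ card U' * ent (V - U') f \<le> (1 - \<theta>) ^ Suc (card (U' - S)) * ent (V - U') f"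
          using cle \<theta> \<theta>1 by (intro mult_right_mono power_decreasing ent_nonneg f) auto
        also have "\<dots> = (1 - \<theta>) ^ card (U' - S) * ((1 - \<theta>) * ent (V - U') f)" by simp
        also have "\<dots> \<le> (1 - \<theta>) ^ card (U' - S) * (ent (V - A) f + ent (V - (U' - S)) f)"
          using carve \<theta>1 by (intro mult_left_mono) auto
        also have "\<dots> = (1 - \<theta>) ^ card (U' - S) * ent (V - A) f
            + (1 - \<theta>) ^ card (U' - S) * ent (V - (U' - S)) f" by (simp add: distrib_left)
        also have "\<dots> \<le> ent (V - A) f + 2 * k * sum w' (U' - S)"
          using IH \<theta> \<theta>1 by (intro add_mono mult_left_le_one_le power_le_one ent_nonneg f) auto
        also have "\<dots> \<le> 2 * k * sum w' S + 2 * k * sum w' (U' - S)" using EA by simp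
        also have "\<dots> = 2 * k * (sum w' S + sum w' (U' - S))" by (simp add: distrib_left)
        also have "sum w' S + sum w' (U' - S) = sum w' U'"
          using SA psubset.hyps(1) by (subst sum.subset_diff[of S U']) auto
        finally show ?thesis .
      qed
    qed
  qed
  \<comment> \<open>Bernoulli keeps the accumulated loss factor at 1 / 2 or more. Together with
    \<open>2 * k\<close> from the collars and \<open>sum w' U \<le> 2 * W\<close> this makes the
    8.\<close>
  have "1 - real (card U) * \<theta> \<le> (1 - \<theta>) ^ card U"
    using Bernoulli_inequality[of "- \<theta>" "card U"] \<theta>1 by simp
  moreover have "real (card U) * \<theta> \<le> real N * \<theta>" using U \<theta> by (intro mult_right_mono) auto
  ultimately have "1 / 2 \<le> (1 - \<theta>) ^ card U" using \<theta>(2) by linarith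
  then have "1 / 2 * ent (V - U) f \<le> (1 - \<theta>) ^ card U * ent (V - U) f"
    by (intro mult_right_mono ent_nonneg f)
  also have "\<dots> \<le> 2 * k * sum w' U" by (rule main) auto
  also have "\<dots> \<le> 2 * k * (2 * W)" using sumU small(2) by (intro mult_left_mono) auto
  finally show "ent (V - U) f \<le> 8 * k * (\<Sum>x\<in>U. ent (V - {x}) f)"
    unfolding W_def w_def by simp
qed

lemma ent_tensor_antimono: "ent_tensor k N \<Longrightarrow> M \<le> N \<Longrightarrow> ent_tensor k M"
  by (auto simp: ent_tensor_def)

section \<open>Choice of the scales\<close>

text \<open>The left side of the last assumption bounds the size of a ball of radius
  \<open>J * R\<close>. Here \<open>R\<close>, of order log N, makes the mixing error per vertex O(1
  / N^2), and \<open>J\<close>, of order log N, exhausts the possible doublings.\<close>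

lemma ent_tensor_recursion:
  assumes ssm: "strong_spatial_mixing V E l C \<delta>" and C: "C > 0" and \<delta>: "0 < \<delta>" "\<delta> < 1"
    and growth: "poly_growth V E a d" and ad: "a > 0" "d > 0"
    and N: "N \<ge> 1" and small: "\<And>m. real m \<le> M \<Longrightarrow> ent_tensor k m" and k: "k \<ge> 0"
    and M: "a * ((ln (2 * real N) / ln 2 + 1)
      * (1 / - ln (1 - \<delta>) * ln ((16 * C + 1) * real N ^ 2) + 2)) powr d \<le> M"
  shows "ent_tensor (8 * k) N"
proof -
  define b where "b = 1 / - ln (1 - \<delta>)"
  have b: "b > 0" unfolding b_def using \<delta> by simp
  have N1: "real N \<ge> 1" using N by simp
  \<comment> \<open>\<open>16 * C + 1\<close> instead of \<open>16 * C\<close> keeps the argument at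
    least 1 when \<open>C\<close> is small, so that \<open>L \<ge> 0\<close>.\<close>
  define L where "L = ln ((16 * C + 1) * real N ^ 2)"
  have arg: "(16 * C + 1) * real N ^ 2 \<ge> 1"
    using mult_mono[of 1 "16 * C + 1" 1 "real N ^ 2"] C N1 by (simp add: one_le_power)
  then have L: "L \<ge> 0" unfolding L_def by (rule ln_ge_zero)
  define R where "R = nat \<lceil>b * L\<rceil> + 1"
  define J where "J = nat \<lceil>ln (2 * real N) / ln 2\<rceil>"
  have J0: "ln (2 * real N) / ln 2 > 0" using N1 by simp
  have J1: "J \<ge> 1" unfolding J_def using J0 by linarith
  have R_le: "real R \<le> b * L + 2" and R_ge: "real R \<ge> b * L"
    unfolding R_def using b L mult_nonneg_nonneg[of b L] by linarith+
  have J_le: "real J \<le> ln (2 * real N) / ln 2 + 1" and J_ge: "real J \<ge> ln (2 * real N) / ln 2"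
    unfolding J_def using J0 by linarith+
  show ?thesis
  proof (rule ent_tensor_step[OF ssm C \<delta> _ k N])
    define m where "m = nat \<lfloor>M\<rfloor>"
    have "0 \<le> a * ((ln (2 * real N) / ln 2 + 1) * (b * L + 2)) powr d" using ad by simp
    then have M0: "M \<ge> 0" using M by (simp add: b_def L_def)
    then show "ent_tensor k m" unfolding m_def by (intro small) linarith
    fix v assume v: "v \<in> V"
    have "real (card {u\<in>V. graph_dist E u v \<le> enat (J * R)}) \<le> a * real (J * R) powr d"
    proof -
      have "J * R \<ge> 1" using J1 by (simp add: R_def)
      then show ?thesis using growth v unfolding poly_growth_def by blast
    qed
    also have "\<dots> \<le> a * ((ln (2 * real N) / ln 2 + 1) * (b * L + 2)) powr d"
      using ad J_le R_le J0 unfolding of_nat_mult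
      by (intro mult_left_mono powr_mono2 mult_mono) auto
    also have "\<dots> \<le> M" using M by (simp add: b_def L_def)
    finally show "card {u\<in>V. graph_dist E u v \<le> enat (J * R)} \<le> m" unfolding m_def by linarith
  next
    have "(1 - \<delta>) ^ R = exp (real R * ln (1 - \<delta>))" using \<delta> by (simp add: exp_of_nat_mult)
    also have "\<dots> \<le> exp (- L)"
    proof -
      have "L = b * L * - ln (1 - \<delta>)" unfolding b_def using \<delta> by simp
      also have "\<dots> \<le> real R * - ln (1 - \<delta>)" using R_ge \<delta> by (intro mult_right_mono) auto
      finally show ?thesis by simp
    qed
    also have "\<dots> = 1 / ((16 * C + 1) * real N ^ 2)"
      unfolding L_def using arg by (simp add: exp_minus inverse_eq_divide)
    finally have "16 * real N ^ 2 * (C * (1 - \<delta>) ^ R) \<le> 16 * real N ^ 2 * (C * (1 / ((16 * C + 1) * real N ^ 2)))"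
      using C by (intro mult_left_mono) auto
    also have "\<dots> = 16 * C / (16 * C + 1)" using N1 by simp
    also have "\<dots> \<le> 1" using C by simp
    finally show "16 * real N ^ 2 * (C * (1 - \<delta>) ^ R) \<le> 1" .
    show "R \<ge> 1" by (simp add: R_def)
    have "2 * real N = 2 powr (ln (2 * real N) / ln 2)" using N1 by (simp add: powr_def)
    also have "\<dots> \<le> 2 powr real J" using J_ge by (intro powr_mono) auto
    finally show "2 * real N \<le> 2 ^ J" by (simp add: powr_realpow)
  qed
qed

section \<open>Glauber dynamics\<close>

definition dens :: "('a \<Rightarrow> nat) \<Rightarrow> nat \<Rightarrow> ('a \<Rightarrow> nat) \<Rightarrow> real" where
  "dens \<sigma> t \<tau> = pmf (glauber V E l \<sigma> t) \<tau> / pmf \<mu> \<tau>"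

lemma dens_nonneg: "dens \<sigma> t \<tau> \<ge> 0"
  by (simp add: dens_def)

lemma resample_set:
  assumes "\<sigma> \<in> set_pmf \<mu>"
  shows "set_pmf \<mu> \<inter> {\<sigma>'. restrict \<sigma>' X = restrict \<sigma> X} = cls X \<sigma>"
    "set_pmf \<mu> \<inter> {\<sigma>'. restrict \<sigma>' X = restrict \<sigma> X} \<noteq> {}"
  using assms by (auto simp: restrict_eq_iff_agree)

lemma set_glauber:
  assumes "\<sigma> \<in> set_pmf \<mu>" "V \<noteq> {}"
  shows "set_pmf (glauber V E l \<sigma> t) \<subseteq> set_pmf \<mu>"
proof (induction t)
  case (Suc t)
  have "set_pmf (glauber_step V E l \<rho>) \<subseteq> set_pmf \<mu>" if "\<rho> \<in> set_pmf \<mu>" for \<rho>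
    using resample_set(2)[OF that] assms(2) by (auto simp: glauber_step_def set_cond_pmf)
  then show ?case using Suc by auto
qed (use assms in auto)

lemma pmf_glauber_step:
  assumes "\<sigma> \<in> set_pmf \<mu>" "V \<noteq> {}" "\<tau> \<in> set_pmf \<mu>"
  shows "pmf (glauber_step V E l \<sigma>) \<tau>
    = (\<Sum>v\<in>V. if agree (V - {v}) \<tau> \<sigma> then pmf \<mu> \<tau> / mass (V - {v}) \<tau> else 0) / card V"
proof -
  have "pmf (cond_pmf \<mu> {\<sigma>'. restrict \<sigma>' (V - {v}) = restrict \<sigma> (V - {v})}) \<tau>
      = (if agree (V - {v}) \<tau> \<sigma> then pmf \<mu> \<tau> / mass (V - {v}) \<tau> else 0)" for v
  proof (subst pmf_cond[OF resample_set(2)[OF assms(1)]])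
    have "measure_pmf.prob \<mu> {\<sigma>'. restrict \<sigma>' (V - {v}) = restrict \<sigma> (V - {v})} = mass (V - {v}) \<sigma>"
      by (rule measure_hardcore_eq_mass) (simp add: restrict_eq_iff_agree)
    moreover have "mass (V - {v}) \<sigma> = mass (V - {v}) \<tau>" if "agree (V - {v}) \<sigma> \<tau>"
      using that by (rule mass_eq)
    ultimately show "(if \<tau> \<in> {\<sigma>'. restrict \<sigma>' (V - {v}) = restrict \<sigma> (V - {v})}
        then pmf \<mu> \<tau> / measure_pmf.prob \<mu> {\<sigma>'. restrict \<sigma>' (V - {v}) = restrict \<sigma> (V - {v})} else 0)
      = (if agree (V - {v}) \<tau> \<sigma> then pmf \<mu> \<tau> / mass (V - {v}) \<tau> else 0)"
      by (auto simp: restrict_eq_iff_agree dest: agree_sym)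
  qed
  then show ?thesis
    unfolding glauber_step_def pmf_bind using assms by (subst integral_pmf_of_set) auto
qed

text \<open>By reversibility the density of the chain evolves under the same operator.\<close>

lemma dens_Suc:
  assumes s: "\<sigma> \<in> set_pmf \<mu>" "V \<noteq> {}" and t: "\<tau> \<in> set_pmf \<mu>"
  shows "dens \<sigma> (Suc t) \<tau> = (\<Sum>v\<in>V. cexp (V - {v}) (dens \<sigma> t) \<tau>) / card V"
proof -
  let ?P = "pmf (glauber V E l \<sigma> t)"
  have pos: "pmf \<mu> \<rho> > 0" if "\<rho> \<in> set_pmf \<mu>" for \<rho> using that by (simp add: pmf_positive_iff)
  have "pmf (glauber V E l \<sigma> (Suc t)) \<tau> = (\<Sum>\<rho>\<in>set_pmf \<mu>. ?P \<rho> * pmf (glauber_step V E l \<rho>) \<tau>)"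
    using set_glauber[OF s]
    by (simp add: pmf_bind integral_measure_pmf_real[OF finite_set_hardcore] mult.commute subset_iff)
  also have "\<dots> = (\<Sum>\<rho>\<in>set_pmf \<mu>. \<Sum>v\<in>V. (if agree (V - {v}) \<tau> \<rho> then
      ?P \<rho> * (pmf \<mu> \<tau> / mass (V - {v}) \<tau> / card V) else 0))"
  proof (intro sum.cong refl)
    fix \<rho> assume r: "\<rho> \<in> set_pmf \<mu>"
    show "?P \<rho> * pmf (glauber_step V E l \<rho>) \<tau> = (\<Sum>v\<in>V. (if agree (V - {v}) \<tau> \<rho> then
      ?P \<rho> * (pmf \<mu> \<tau> / mass (V - {v}) \<tau> / card V) else 0))"
      unfolding pmf_glauber_step[OF r s(2) t] sum_divide_distrib sum_distrib_left
      by (rule sum.cong) simp_all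
  qed
  also have "\<dots> = (\<Sum>v\<in>V. \<Sum>\<rho>\<in>set_pmf \<mu>. (if agree (V - {v}) \<tau> \<rho> then
      ?P \<rho> * (pmf \<mu> \<tau> / mass (V - {v}) \<tau> / card V) else 0))" by (rule sum.swap)
  also have "\<dots> = (\<Sum>v\<in>V. pmf \<mu> \<tau> * cexp (V - {v}) (dens \<sigma> t) \<tau> / card V)"
  proof (intro sum.cong refl)
    fix v assume "v \<in> V"
    have "(\<Sum>\<rho>\<in>set_pmf \<mu>. (if agree (V - {v}) \<tau> \<rho> then ?P \<rho> * (pmf \<mu> \<tau> / mass (V - {v}) \<tau> / card V) else 0))
        = (\<Sum>\<rho>\<in>cls (V - {v}) \<tau>. ?P \<rho> * (pmf \<mu> \<tau> / mass (V - {v}) \<tau> / card V))"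
      unfolding cls_def by (rule sum.inter_filter[symmetric]) (rule finite_set_hardcore)
    also have "\<dots> = (\<Sum>\<rho>\<in>cls (V - {v}) \<tau>. ?P \<rho>) * (pmf \<mu> \<tau> / mass (V - {v}) \<tau> / card V)"
      by (rule sum_distrib_right[symmetric])
    also have "(\<Sum>\<rho>\<in>cls (V - {v}) \<tau>. ?P \<rho>) = (\<Sum>\<rho>\<in>cls (V - {v}) \<tau>. pmf \<mu> \<rho> * dens \<sigma> t \<rho>)"
      using pos by (intro sum.cong refl) (auto simp: dens_def less_le)
    finally show "(\<Sum>\<rho>\<in>set_pmf \<mu>. (if agree (V - {v}) \<tau> \<rho> then ?P \<rho> * (pmf \<mu> \<tau> / mass (V - {v}) \<tau> / card V) else 0))
      = pmf \<mu> \<tau> * cexp (V - {v}) (dens \<sigma> t) \<tau> / card V" by (simp add: cexp_def)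
  qed
  finally show ?thesis
    using pos[OF t] by (simp add: dens_def[of _ "Suc t"] sum_distrib_left[symmetric] sum_divide_distrib[symmetric])
qed

lemma sum_hardcore: "(\<Sum>\<tau>\<in>set_pmf \<mu>. pmf \<mu> \<tau>) = 1"
  by (rule sum_pmf_eq_1) (auto simp: finite_set_hardcore)

lemma mean_dens:
  assumes "\<sigma> \<in> set_pmf \<mu>" "V \<noteq> {}"
  shows "cexp {} (dens \<sigma> t) \<tau> = 1"
proof -
  have "(\<Sum>\<tau>\<in>set_pmf \<mu>. pmf \<mu> \<tau> * dens \<sigma> t \<tau>) = (\<Sum>\<tau>\<in>set_pmf \<mu>. pmf (glauber V E l \<sigma> t) \<tau>)"
    by (intro sum.cong) (auto simp: dens_def set_pmf_iff)
  also have "\<dots> = 1" using set_glauber[OF assms] by (intro sum_pmf_eq_1) (auto simp: finite_set_hardcore)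
  finally show ?thesis by (simp add: cexp_def mass_def sum_hardcore)
qed

section \<open>Entropy decay and mixing time\<close>

text \<open>Convexity passes from the average over \<open>v\<close> to single resamplings, for which
  the chain rule gives the exact loss; tensorization with all of \<open>V\<close> free bounds the
  average loss from below.\<close>

lemma ent_dens_Suc:
  assumes s: "\<sigma> \<in> set_pmf \<mu>" "V \<noteq> {}" and k: "ent_tensor k (card V)" "k > 0"
  shows "ent {} (dens \<sigma> (Suc t)) \<le> (1 - 1 / (k * card V)) * ent {} (dens \<sigma> t)"
proof -
  let ?f = "dens \<sigma> t"
  have n: "real (card V) > 0" using s(2) by (simp add: card_gt_0_iff)
  have "ent {} (dens \<sigma> (Suc t)) = ent {} (\<lambda>\<tau>. (\<Sum>v\<in>V. cexp (V - {v}) ?f \<tau>) / card V)"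
    by (rule ent_cong) (rule dens_Suc[OF s])
  also have "\<dots> \<le> (\<Sum>v\<in>V. ent {} (cexp (V - {v}) ?f)) / card V"
  proof (rule ent_mean_le)
    show "cexp {} (cexp (V - {v}) ?f) \<tau> = 1" if "\<tau> \<in> set_pmf \<mu>" for v \<tau>
      using cexp_tower[of "{}" "V - {v}" \<tau> ?f] mean_dens[OF s] that by simp
  qed (use s in \<open>auto intro!: cexp_nonneg dens_nonneg\<close>)
  also have "\<dots> = (\<Sum>v\<in>V. ent {} ?f - ent (V - {v}) ?f) / card V"
    by (simp add: ent_cexp dens_nonneg)
  also have "\<dots> = ent {} ?f - (\<Sum>v\<in>V. ent (V - {v}) ?f) / card V"
    using s(2) by (simp add: sum_subtractf diff_divide_distrib)
  also have "\<dots> \<le> ent {} ?f - ent {} ?f / k / card V"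
  proof -
    have "ent (V - V) ?f \<le> k * (\<Sum>v\<in>V. ent (V - {v}) ?f)"
      using k(1) dens_nonneg unfolding ent_tensor_def by blast
    then have "ent {} ?f / k \<le> (\<Sum>v\<in>V. ent (V - {v}) ?f)"
      using k(2) by (simp add: pos_divide_le_eq mult.commute)
    then show ?thesis using n by (intro diff_left_mono divide_right_mono) auto
  qed
  finally show ?thesis by (simp add: algebra_simps)
qed

text \<open>The density of a point mass has entropy minus the logarithm of the probability of the
  point, and probabilities in the support are at worst exponentially small in
  \<open>card V\<close>.\<close>

lemma ent_dens_0:
  assumes s: "\<sigma> \<in> set_pmf \<mu>" "V \<noteq> {}"
  shows "ent {} (dens \<sigma> 0) \<le> card V * ln (2 * max 1 l / min 1 l)"
proof -
  let ?r = "min 1 l / (2 * max 1 l)"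
  have r: "?r > 0" using l_pos by simp
  have ps: "pmf \<mu> \<sigma> > 0" using s by (simp add: pmf_positive_iff)
  have "ent {} (dens \<sigma> 0) = (\<Sum>\<tau>\<in>set_pmf \<mu>. if \<tau> = \<sigma> then - ln (pmf \<mu> \<sigma>) else 0)"
    unfolding ent_def mean_dens[OF s] using ps
    by (intro sum.cong refl) (auto simp: dens_def ln_div)
  also have "\<dots> = - ln (pmf \<mu> \<sigma>)" using s by (simp add: finite_set_hardcore)
  also have "\<dots> \<le> - ln (?r ^ card V)"
    using cond_prob_lower_bound[OF s(1) order_refl order_refl, of \<sigma>] s r ps
    by (simp add: mass_def sum_hardcore agree_def)
  also have "\<dots> = card V * ln (inverse ?r)" using r by (simp only: ln_realpow ln_inverse)
  also have "inverse ?r = 2 * max 1 l / min 1 l" by simp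
  finally show ?thesis .
qed

text \<open>The difference on any event is at most the L1 distance of the density from 1, to which
  Pinsker applies with mean 1.\<close>

lemma tv_distance_le:
  assumes s: "\<sigma> \<in> set_pmf \<mu>" "V \<noteq> {}"
  shows "tv_distance (glauber V E l \<sigma> t) \<mu> \<le> 2 * sqrt (ent {} (dens \<sigma> t))"
proof -
  let ?f = "dens \<sigma> t"
  have "\<bar>measure_pmf.prob (glauber V E l \<sigma> t) A - measure_pmf.prob \<mu> A\<bar> \<le> 2 * sqrt (ent {} ?f)" for A
  proof -
    have m: "measure_pmf.prob q A = (\<Sum>\<tau>\<in>A \<inter> set_pmf \<mu>. pmf q \<tau>)" if "set_pmf q \<subseteq> set_pmf \<mu>" for q
    proof -
      have "measure_pmf.prob q A = measure_pmf.prob q (A \<inter> set_pmf \<mu>)"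
        using that measure_Int_set_pmf[of q A] measure_Int_set_pmf[of q "A \<inter> set_pmf \<mu>"]
        by (metis Int_assoc Int_absorb1)
      then show ?thesis by (simp add: measure_measure_pmf_finite finite_set_hardcore)
    qed
    have "measure_pmf.prob (glauber V E l \<sigma> t) A - measure_pmf.prob \<mu> A
        = (\<Sum>\<tau>\<in>A \<inter> set_pmf \<mu>. pmf \<mu> \<tau> * (?f \<tau> - 1))"
      unfolding m[OF set_glauber[OF s]] m[OF order_refl] sum_subtractf[symmetric]
      by (intro sum.cong) (auto simp: dens_def set_pmf_iff right_diff_distrib)
    also have "\<bar>\<dots>\<bar> \<le> (\<Sum>\<tau>\<in>A \<inter> set_pmf \<mu>. pmf \<mu> \<tau> * \<bar>?f \<tau> - 1\<bar>)"
      by (rule order_trans[OF sum_abs]) (simp add: abs_mult)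
    also have "\<dots> \<le> (\<Sum>\<tau>\<in>set_pmf \<mu>. pmf \<mu> \<tau> * \<bar>?f \<tau> - 1\<bar>)"
      by (intro sum_mono2) (auto simp: finite_set_hardcore)
    also have "\<dots> = cexp {} (\<lambda>\<tau>. \<bar>?f \<tau> - 1\<bar>) \<sigma>" by (simp add: cexp_def mass_def sum_hardcore)
    also have "\<dots> \<le> sqrt (4 * cexp {} (\<lambda>\<tau>. ?f \<tau> * ln (?f \<tau> / 1)) \<sigma>)"
      using pinsker[where f = ?f and X = "{}", OF s(1) dens_nonneg]
      unfolding mean_dens[OF s] by (intro real_le_rsqrt) simp
    also have "cexp {} (\<lambda>\<tau>. ?f \<tau> * ln (?f \<tau> / 1)) \<sigma> = ent {} ?f"
      unfolding ent_def mean_dens[OF s] by (simp add: cexp_def mass_def sum_hardcore)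
    also have "sqrt (4 * ent {} ?f) = 2 * sqrt (ent {} ?f)" by (simp add: real_sqrt_mult)
    finally show ?thesis .
  qed
  then show ?thesis unfolding tv_distance_def by (intro cSUP_least) auto
qed

text \<open>The 64 stems from the target entropy 1 / 64, at which twice the square root of the
  entropy is 1 / 4.\<close>

lemma glauber_mixing_time_le:
  fixes k :: real
  assumes V: "V \<noteq> {}" and k: "ent_tensor k (card V)" "k \<ge> 1"
    and t: "k * card V * ln (64 * (card V * ln (2 * max 1 l / min 1 l))) \<le> real t"
  shows "glauber_mixing_time V E l \<le> enat t"
proof -
  define n where "n = real (card V)"
  define c where "c = ln (2 * max 1 l / min 1 l)"
  have "card V > 0" using V by (simp add: card_gt_0_iff)
  then have n: "n \<ge> 1" by (simp add: n_def)
  have c: "c > 0"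
    unfolding c_def using l_pos by (intro ln_gt_zero) (auto simp: min_def max_def)
  have kn: "k * n \<ge> 1" using k n mult_mono[of 1 k 1 n] by simp
  have "tv_distance (glauber V E l \<sigma> t) \<mu> \<le> 1 / 4" if s: "\<sigma> \<in> set_pmf \<mu>" for \<sigma>
  proof -
    have dec: "ent {} (dens \<sigma> t) \<le> (1 - 1 / (k * n)) ^ t * (n * c)" for t
    proof (induction t)
      case 0
      then show ?case using ent_dens_0[OF s V] by (simp add: n_def c_def)
    next
      case (Suc t)
      have "ent {} (dens \<sigma> (Suc t)) \<le> (1 - 1 / (k * n)) * ent {} (dens \<sigma> t)"
        using ent_dens_Suc[OF s V k(1)] k(2) by (simp add: n_def)
      also have "\<dots> \<le> (1 - 1 / (k * n)) * ((1 - 1 / (k * n)) ^ t * (n * c))"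
        using Suc kn by (intro mult_left_mono) auto
      finally show ?case by (simp add: mult_ac)
    qed
    have "(1 - 1 / (k * n)) ^ t \<le> exp (- (1 / (k * n))) ^ t"
      using kn exp_ge_add_one_self[of "- (1 / (k * n))"] by (intro power_mono) auto
    also have "\<dots> = exp (- (t / (k * n)))" by (simp add: exp_of_nat_mult[symmetric])
    also have "\<dots> \<le> exp (- ln (64 * (n * c)))"
      using t kn by (simp add: n_def[symmetric] c_def[symmetric] pos_le_divide_eq mult_ac)
    also have "\<dots> = 1 / (64 * (n * c))" using n c by (simp add: exp_minus inverse_eq_divide)
    finally have "(1 - 1 / (k * n)) ^ t * (n * c) \<le> 1 / (64 * (n * c)) * (n * c)"
      using n c by (intro mult_right_mono) auto
    also have "\<dots> = 1 / 64" using n c by simp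
    finally have "ent {} (dens \<sigma> t) \<le> 1 / 64" using dec[of t] by linarith
    then have "sqrt (ent {} (dens \<sigma> t)) \<le> sqrt ((1 / 8)\<^sup>2)"
      by (intro real_sqrt_le_mono) (simp add: power2_eq_square)
    then show ?thesis using tv_distance_le[OF s V, of t] by simp
  qed
  then show ?thesis unfolding glauber_mixing_time_def by (intro Inf_lower) auto
qed

end

section \<open>Closing the recursion\<close>

text \<open>\<open>M\<close> is of the order of a power of ln N, so \<open>ln (M + 2)\<close> is of
  order ln ln N and leaves room for any constant factor; the 8 is the loss of one level.\<close>

lemma scale_recursion_eventually:
  fixes a b c d :: real
  assumes "a > 0" "b > 0" "c > 1" "d > 0"
  shows "\<exists>N0\<ge>1. \<forall>N>N0. let M = a * ((ln (2 * real N) / ln 2 + 1) * (b * ln (c * real N ^ 2) + 2)) powr d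
    in M < real N \<and> 8 * ln (M + 2) ^ 2 \<le> ln (real N + 2) ^ 2"
proof -
  let ?M = "\<lambda>x::real. a * ((ln (2 * x) / ln 2 + 1) * (b * ln (c * x ^ 2) + 2)) powr d"
  have "eventually (\<lambda>x. ?M x < x) at_top" using assms by real_asymp
  moreover have "eventually (\<lambda>x. 8 * ln (?M x + 2) ^ 2 \<le> ln (x + 2) ^ 2) at_top"
    using assms by real_asymp
  ultimately have "eventually (\<lambda>x. ?M x < x \<and> 8 * ln (?M x + 2) ^ 2 \<le> ln (x + 2) ^ 2) at_top"
    by (rule eventually_conj)
  then have "eventually (\<lambda>N. ?M (real N) < real N \<and> 8 * ln (?M (real N) + 2) ^ 2 \<le> ln (real N + 2) ^ 2) sequentially"
    by (rule eventually_compose_filterlim) (rule filterlim_real_sequentially)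
  then obtain N0 where "\<And>N. N \<ge> N0 \<Longrightarrow> ?M (real N) < real N \<and> 8 * ln (?M (real N) + 2) ^ 2 \<le> ln (real N + 2) ^ 2"
    by (auto simp: eventually_sequentially)
  then show ?thesis by (intro exI[of _ "max 1 N0"]) (auto simp: Let_def)
qed

text \<open>Placed outside the locale because \<open>A\<close> must be chosen before the graph. The
  2 in \<open>ln (real N + 2)\<close> bounds the logarithm below by \<open>ln 2\<close>, so that the
  base case holds down to \<open>N = 0\<close>.\<close>

lemma ent_tensor_polylog:
  fixes a d l C \<delta> :: real
  assumes "a > 0" "d > 0" "l > 0" "C > 0" "0 < \<delta>" "\<delta> < 1"
  shows "\<exists>A\<ge>1. \<forall>(V :: 'a set) E N. hardcore_model V E l \<longrightarrow> poly_growth V E a d \<longrightarrow>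
    strong_spatial_mixing V E l C \<delta> \<longrightarrow> hardcore_model.ent_tensor V E l (A * ln (real N + 2) ^ 2) N"
proof -
  let ?M = "\<lambda>N. a * ((ln (2 * real N) / ln 2 + 1)
    * (1 / - ln (1 - \<delta>) * ln ((16 * C + 1) * real N ^ 2) + 2)) powr d"
  obtain N0 where N0: "N0 \<ge> 1"
    "\<And>N. N > N0 \<Longrightarrow> ?M N < real N \<and> 8 * ln (?M N + 2) ^ 2 \<le> ln (real N + 2) ^ 2"
    using scale_recursion_eventually[of a "1 / - ln (1 - \<delta>)" "16 * C + 1" d] assms
    by (auto simp: Let_def)
  define K where "K = 32 * real N0 ^ 2 / (min 1 l / (2 * max 1 l)) ^ N0"
  have K: "K \<ge> 0" unfolding K_def using assms by simp
  \<comment> \<open>Chosen so that \<open>A * ln 2 ^ 2\<close> is at least \<open>K\<close>, which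
    settles every \<open>N \<le> N0\<close>.\<close>
  define A where "A = K / ln 2 ^ 2 + 1"
  have A: "A \<ge> 1" unfolding A_def using K by simp
  have "hardcore_model.ent_tensor V E l (A * ln (real N + 2) ^ 2) N"
    if hm: "hardcore_model V E l" and g: "poly_growth V E a d" and ssm: "strong_spatial_mixing V E l C \<delta>"
    for V :: "'a set" and E N
  proof (induction N rule: less_induct)
    case (less N)
    interpret hardcore_model V E l by (rule hm)
    show ?case
    proof (cases "N \<le> N0")
      case True
      have "ent_tensor K N" using ent_tensor_antimono[OF ent_tensor_crude True] by (simp add: K_def)
      moreover have "K \<le> A * ln (real N + 2) ^ 2"
      proof -
        have "K \<le> A * ln 2 ^ 2" by (simp add: A_def field_simps)
        also have "\<dots> \<le> A * ln (real N + 2) ^ 2" using A by (intro mult_left_mono power_mono) auto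
        finally show ?thesis .
      qed
      ultimately show ?thesis by (rule ent_tensor_mono)
    next
      case False
      then have M: "?M N < real N" "8 * ln (?M N + 2) ^ 2 \<le> ln (real N + 2) ^ 2" using N0(2)[of N] by auto
      have M0: "?M N \<ge> 0" using assms by simp
      \<comment> \<open>The bound at scale \<open>M\<close> times the loss 8; by the choice of
        \<open>N0\<close> this does not exceed the bound at scale \<open>N\<close>.\<close>
      have "ent_tensor (8 * (A * ln (?M N + 2) ^ 2)) N"
      proof (rule ent_tensor_recursion[OF ssm assms(4-6) g assms(1,2) _ _ _ order_refl])
        show "N \<ge> 1" using False N0(1) by simp
        show "0 \<le> A * ln (?M N + 2) ^ 2" using A by simp
        fix m assume m: "real m \<le> ?M N"
        then have "ent_tensor (A * ln (real m + 2) ^ 2) m" using M(1) by (intro less.IH) linarith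
        moreover have "A * ln (real m + 2) ^ 2 \<le> A * ln (?M N + 2) ^ 2"
          using m A by (intro mult_left_mono power_mono) auto
        ultimately show "ent_tensor (A * ln (?M N + 2) ^ 2) m" by (rule ent_tensor_mono)
      qed
      moreover have "8 * (A * ln (?M N + 2) ^ 2) \<le> A * ln (real N + 2) ^ 2"
        using mult_left_mono[OF M(2), of A] A by (simp add: mult_ac)
      ultimately show ?thesis by (rule ent_tensor_mono)
    qed
  qed
  then show ?thesis using A by blast
qed

text \<open>The implied constant is chosen before the graph. A single vertex is left out because ln
  1 = 0, whereas the chain then needs one step.\<close>

theorem theorem5p7:
  fixes a d l C \<delta> :: real
  assumes "a > 0" and "d > 0" and "l > 0" and "C > 0" and "0 < \<delta>" and "\<delta> < 1"
  shows "\<exists>K>0. \<forall>(V :: 'a set) E.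
    simple_graph V E \<longrightarrow> card V \<ge> 2 \<longrightarrow>
    poly_growth V E a d \<longrightarrow> strong_spatial_mixing V E l C \<delta> \<longrightarrow>
    ereal_of_enat (glauber_mixing_time V E l)
      \<le> ereal (K * (real (card V) * ln (real (card V)) ^ 3))"
proof -
  obtain A where A: "A \<ge> 1" and tensor: "\<And>(V :: 'a set) E N. hardcore_model V E l \<Longrightarrow> poly_growth V E a d \<Longrightarrow>
    strong_spatial_mixing V E l C \<delta> \<Longrightarrow> hardcore_model.ent_tensor V E l (A * ln (real N + 2) ^ 2) N"
    using ent_tensor_polylog[OF assms] by metis
  \<comment> \<open>Collects the target accuracy and the initial entropy per vertex;
    \<open>max 1\<close> keeps \<open>ln c\<close> nonnegative.\<close>
  define c where "c = 64 * max 1 (ln (2 * max 1 l / min 1 l))"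
  have c: "c \<ge> 1" "64 * ln (2 * max 1 l / min 1 l) \<le> c" by (auto simp: c_def)
  \<comment> \<open>The 4 comes from squaring \<open>ln (n + 2) \<le> 2 * ln n\<close>, the factor
    \<open>1 + ln c / ln 2\<close> from absorbing \<open>c\<close> into \<open>ln n\<close>, and the
    last summand pays for rounding \<open>t\<close> up.\<close>
  define K where "K = 4 * A * (1 + ln c / ln 2) + 1 / ln 2 ^ 3"
  have lnc: "ln c \<ge> 0" using c by simp
  have K: "K > 0" unfolding K_def using A lnc by (intro add_nonneg_pos) auto
  have "ereal_of_enat (glauber_mixing_time V E l) \<le> ereal (K * (real (card V) * ln (real (card V)) ^ 3))"
    if g: "simple_graph V E" and cV: "card V \<ge> 2" and pg: "poly_growth V E a d"
      and ssm: "strong_spatial_mixing V E l C \<delta>" for V :: "'a set" and E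
  proof -
    interpret hardcore_model V E l using g assms by unfold_locales
    define n where "n = real (card V)"
    have n: "n \<ge> 2" using cV by (simp add: n_def)
    define k where "k = A * ln (n + 2) ^ 2"
    define t where "t = nat \<lceil>k * n * ln (c * n)\<rceil>"
    have ln2: "ln 2 \<le> ln n" "ln n > 0" using n by auto
    have k1: "k \<ge> 1"
    proof -
      have "exp 1 \<le> (4::real)" using exp_le by simp
      then have "1 \<le> ln (4::real)" by (simp add: ln_ge_iff)
      also have "\<dots> \<le> ln (n + 2)" using n by simp
      finally have "1 \<le> ln (n + 2) ^ 2" by (rule one_le_power)
      then show ?thesis unfolding k_def using A mult_mono[of 1 A 1 "ln (n + 2) ^ 2"] by simp
    qed
    have cn: "c * n \<ge> 1" using c n mult_mono[of 1 c 1 n] by simp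
    then have x0: "k * n * ln (c * n) \<ge> 0" using k1 n by simp
    have c0: "ln (2 * max 1 l / min 1 l) > 0"
      using assms(3) by (intro ln_gt_zero) (auto simp: min_def max_def)
    have mix: "glauber_mixing_time V E l \<le> enat t"
    proof (rule glauber_mixing_time_le)
      show "V \<noteq> {}" using cV by auto
      show "ent_tensor k (card V)"
        unfolding k_def n_def using hardcore_model_axioms pg ssm by (rule tensor)
      show "k \<ge> 1" by (rule k1)
      have "ln (64 * (n * ln (2 * max 1 l / min 1 l))) \<le> ln (c * n)"
        using c0 n mult_right_mono[OF c(2), of n] by (intro ln_mono) (auto simp: mult_ac)
      then have "k * n * ln (64 * (n * ln (2 * max 1 l / min 1 l))) \<le> k * n * ln (c * n)"
        using k1 n by (intro mult_left_mono) auto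
      also have "\<dots> \<le> real t" unfolding t_def by linarith
      finally show "k * card V * ln (64 * (card V * ln (2 * max 1 l / min 1 l))) \<le> real t"
        by (simp add: n_def)
    qed
    have t: "real t \<le> K * (n * ln n ^ 3)"
    proof -
      have 1: "real t \<le> k * n * ln (c * n) + 1" unfolding t_def using x0 by linarith
      have 2: "k * n * ln (c * n) \<le> (A * (2 * ln n) ^ 2) * n * ((1 + ln c / ln 2) * ln n)"
      proof (rule mult_mono)
        have "n + 2 \<le> n ^ 2" using n mult_right_mono[of 2 n n] unfolding power2_eq_square by linarith
        then have "ln (n + 2) \<le> ln (n ^ 2)" using n by (intro ln_mono) auto
        also have "\<dots> = 2 * ln n" using n by (simp add: ln_realpow)
        finally have "ln (n + 2) \<le> 2 * ln n" .
        then show "k * n \<le> A * (2 * ln n) ^ 2 * n"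
          unfolding k_def using A n by (intro mult_right_mono mult_left_mono power_mono) auto
        have "ln (c * n) = ln c / ln 2 * ln 2 + ln n" using c n by (simp add: ln_mult)
        also have "\<dots> \<le> ln c / ln 2 * ln n + ln n" using lnc ln2 by (intro add_right_mono mult_left_mono) auto
        finally show "ln (c * n) \<le> (1 + ln c / ln 2) * ln n" by (simp add: algebra_simps)
      qed (use A n cn in auto)
      have 3: "1 \<le> 1 / ln 2 ^ 3 * (n * ln n ^ 3)"
      proof -
        have "(ln 2) ^ 3 \<le> ln n ^ 3" using ln2 by (intro power_mono) auto
        also have "\<dots> \<le> n * ln n ^ 3" using n ln2 by simp
        finally show ?thesis by (simp add: pos_le_divide_eq)
      qed
      have "K * (n * ln n ^ 3) = A * (2 * ln n) ^ 2 * n * ((1 + ln c / ln 2) * ln n) + 1 / ln 2 ^ 3 * (n * ln n ^ 3)"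
        unfolding K_def by (simp add: algebra_simps power2_eq_square power3_eq_cube)
      then show ?thesis using 1 2 3 by linarith
    qed
    have "ereal_of_enat (glauber_mixing_time V E l) \<le> ereal_of_enat (enat t)"
      using mix by (simp only: ereal_of_enat_le_iff)
    also have "\<dots> \<le> ereal (K * (n * ln n ^ 3))" using t by simp
    finally show ?thesis by (simp add: n_def)
  qed
  then show ?thesis using K by blast
qed

end
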